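(* Fix $\alpha\in(0,1)$, $\delta\in(0,1)$ and $\alpha_0\in(0,\alpha)$. Let $\mathbf{Y}^1,\dots,\mathbf{Y}^n$ be i.i.d. Gaussian vectors in $\mathbb{R}^K$ with mean $\mu$, and consider the two-sided multiple testing problem of testing simultaneously $H_k$: "$\mu_k=0$" against $A_k$: "$\mu_k\ne0$" for $1\le k\le K$. Let $\mathcal{H}=\{1,\dots,K\}$ and consider the following algorithm. Step 1. Let $R_0=\{k\in\mathcal{H}\mid|\overline{\mathbf{Y}}_k|>t_{\alpha,\mathrm{quant}+\mathrm{Bonf}}(\mathbf{Y},\mathcal{H})\}$, where the threshold is computed with the given $\delta$ and $\alpha_0$. Step 2. If $R_0=\mathcal{H}$, stop and reject all of the null hypotheses. Otherwise, let $\mathcal{C}_0=\mathcal{H}\setminus R_0$, define $\mathcal{C}_j=\{k\in\mathcal{C}_{j-1}\mid|\overline{\mathbf{Y}}_k|\le q_{\alpha_0}(\mathbf{Y},\mathcal{C}_{j-1})\}$ for $j\ge1$, let $\hat\ell=\min\{j\ge1\mid\mathcal{C}_j=\mathcal{C}_{j-1}\}$, and reject the hypotheses $H_k$ for $k\in\mathcal{H}\setminus\mathcal{C}_{\hat\ell}$. Then this multiple testing procedure has family-wise error rate upper bounded by $\alpha$: the probability that at least one $H_k$ with $\mu_k=0$ is rejected is at most $\alpha$.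
   Context: $K\ge1$ and $n\ge2$ are integers; the common covariance matrix of the $\mathbf{Y}^i$ is arbitrary. $\mathbf{Y}$ is the $K\times n$ matrix with columns $\mathbf{Y}^i$, $\overline{\mathbf{Y}}=\frac1n\sum_{i=1}^n\mathbf{Y}^i$, and $\mathbf{Y}-\overline{\mathbf{Y}}$ is the matrix with columns $\mathbf{Y}^i-\overline{\mathbf{Y}}$. For $\mathcal{C}\subset\mathcal{H}$, $\|\sigma\|_{\mathcal{C}}=\sup_{k\in\mathcal{C}}\sigma_k$ with $\sigma_k=\mathrm{Var}^{1/2}(\mathbf{Y}^1_k)$. $\overline{\Phi}(x)=\mathbb{P}(X\ge x)$ for $X\sim\mathcal N(0,1)$. Let $W=(W_1,\dots,W_n)$ be i.i.d. Rademacher variables ($\pm1$ with probability $1/2$), independent of $\mathbf{Y}$, and $\mathbb{P}_W$ the probability over $W$ only. For a $K\times n$ matrix $\mathbf{X}$, $\mathcal{C}\subset\mathcal{H}$ and $\eta\in(0,1)$, define (two-sided case) $$q_\eta(\mathbf{X},\mathcal{C})=\inf\Big\{x\in\mathbb{R}\,\Big|\,\mathbb{P}_W\Big(\sup_{k\in\mathcal{C}}\Big|\frac1n\sum_{i=1}^nW_i\mathbf{X}^i_k\Big|>x\Big)\le\eta\Big\},$$ $$t_{\eta,\mathrm{Bonf}}(\mathbf{Y},\mathcal{C})=\frac{1}{\sqrt n}\|\sigma\|_{\mathcal{C}}\,\overline{\Phi}^{-1}\Big(\frac{\eta}{2|\mathcal{C}|}\Big),$$ $$\gamma_n(\eta)=\frac{2\overline{\mathcal{B}}(n,\eta/2)-n}{n},\qquad\overline{\mathcal{B}}(n,\eta)=\max\Big\{k\in\{0,\dots,n\}\,\Big|\,2^{-n}\sum_{i=k}^n\binom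 ni\ge\eta\Big\},$$ $$t_{\alpha,\mathrm{quant}+\mathrm{Bonf}}(\mathbf{Y},\mathcal{C})=q_{\alpha_0(1-\delta)}(\mathbf{Y}-\overline{\mathbf{Y}},\mathcal{C})+\gamma_n(\alpha_0\delta)\,t_{\alpha-\alpha_0,\mathrm{Bonf}}(\mathbf{Y},\mathcal{C}).$$ *)

theory Defs
  imports "HOL-Probability.Probability"
begin

text \<open>
  The hypotheses are indexed by a finite type \<open>'k\<close>, so that \<open>K = CARD('k)\<close> and
  \<open>\<H> = UNIV\<close>. A \<open>K \<times> n\<close> matrix is given by its columns \<open>X 1, \<dots>, X n\<close>, as a function
  from \<open>nat\<close> to vectors; its values outside \<open>{1..n}\<close> are never used.
\<close>

text \<open>
  A random vector is Gaussian if all its linear forms are normal. The covariance matrix may be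
  singular, so a linear form is also allowed to be almost surely constant.
\<close>

definition gaussian_vector :: "'a measure \<Rightarrow> ('a \<Rightarrow> real ^ 'k) \<Rightarrow> bool" where
  "gaussian_vector M Z \<longleftrightarrow>
     Z \<in> borel_measurable M \<and>
     (\<forall>a. (\<exists>m s. s > 0 \<and> distributed M lborel (\<lambda>\<omega>. a \<bullet> Z \<omega>) (\<lambda>x. ennreal (normal_density m s x))) \<or>
          (\<exists>m. AE \<omega> in M. a \<bullet> Z \<omega> = m))"

definition coord_sd :: "'a measure \<Rightarrow> ('a \<Rightarrow> real ^ 'k) \<Rightarrow> 'k \<Rightarrow> real" where
  "coord_sd M Z k = sqrt (prob_space.variance M (\<lambda>\<omega>. Z \<omega> $ k))"

definition sample_mean :: "nat \<Rightarrow> (nat \<Rightarrow> real ^ 'k) \<Rightarrow> real ^ 'k" where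
  "sample_mean n X = (1 / real n) *\<^sub>R (\<Sum>i=1..n. X i)"

definition centered :: "nat \<Rightarrow> (nat \<Rightarrow> real ^ 'k) \<Rightarrow> nat \<Rightarrow> real ^ 'k" where
  "centered n X i = X i - sample_mean n X"

definition rademacher_signs :: "nat \<Rightarrow> (nat \<Rightarrow> real) pmf" where
  "rademacher_signs n = Pi_pmf {1..n} 0 (\<lambda>_. pmf_of_set {-1, 1})"

text \<open>
  The two-sided quantile \<open>q\<^sub>\<eta>(X, C)\<close>. It is only meaningful for nonempty \<open>C\<close>.
\<close>

definition resampling_quantile ::
    "nat \<Rightarrow> real \<Rightarrow> (nat \<Rightarrow> real ^ 'k) \<Rightarrow> 'k set \<Rightarrow> real" where
  "resampling_quantile n \<eta> X C =
     Inf {x. measure_pmf.prob (rademacher_signs n)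
               {w. (SUP k\<in>C. \<bar>1 / real n * (\<Sum>i=1..n. w i * X i $ k)\<bar>) > x} \<le> \<eta>}"

definition normal_upper_tail :: "real \<Rightarrow> real" where
  "normal_upper_tail x = measure (density lborel (\<lambda>x. ennreal (std_normal_density x))) {x..}"

text \<open>
  In the thresholds, \<open>\<sigma>\<close> is the vector of the coordinate standard deviations. It belongs to the
  distribution of the data, and not to the observed matrix \<open>X\<close>. The function
  \<open>normal_upper_tail\<close> is a bijection onto the open interval \<open>(0, 1)\<close>, to which the argument of
  its inverse belongs whenever \<open>C\<close> is nonempty and \<open>\<eta> \<in> (0, 1)\<close>.
\<close>

definition bonf_threshold :: "nat \<Rightarrow> ('k \<Rightarrow> real) \<Rightarrow> real \<Rightarrow> 'k set \<Rightarrow> real" where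
  "bonf_threshold n \<sigma> \<eta> C =
     1 / sqrt (real n) * (SUP k\<in>C. \<sigma> k) * inv normal_upper_tail (\<eta> / (2 * real (card C)))"

definition binom_upper_quantile :: "nat \<Rightarrow> real \<Rightarrow> nat" where
  "binom_upper_quantile n \<eta> =
     Max {k \<in> {0..n}. (\<Sum>i=k..n. real (n choose i)) / 2 ^ n \<ge> \<eta>}"

definition gamma_factor :: "nat \<Rightarrow> real \<Rightarrow> real" where
  "gamma_factor n \<eta> = (2 * real (binom_upper_quantile n (\<eta> / 2)) - real n) / real n"

definition quant_bonf_threshold ::
    "nat \<Rightarrow> ('k \<Rightarrow> real) \<Rightarrow> real \<Rightarrow> real \<Rightarrow> real \<Rightarrow> (nat \<Rightarrow> real ^ 'k) \<Rightarrow> 'k set \<Rightarrow> real" where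
  "quant_bonf_threshold n \<sigma> \<alpha> \<alpha>0 \<delta> X C =
     resampling_quantile n (\<alpha>0 * (1 - \<delta>)) (centered n X) C
       + gamma_factor n (\<alpha>0 * \<delta>) * bonf_threshold n \<sigma> (\<alpha> - \<alpha>0) C"

definition initial_rejections ::
    "nat \<Rightarrow> ('k::finite \<Rightarrow> real) \<Rightarrow> real \<Rightarrow> real \<Rightarrow> real \<Rightarrow> (nat \<Rightarrow> real ^ 'k) \<Rightarrow> 'k set" where
  "initial_rejections n \<sigma> \<alpha> \<alpha>0 \<delta> X =
     {k. \<bar>sample_mean n X $ k\<bar> > quant_bonf_threshold n \<sigma> \<alpha> \<alpha>0 \<delta> X UNIV}"

primrec step_down_sets ::
    "nat \<Rightarrow> real \<Rightarrow> (nat \<Rightarrow> real ^ 'k) \<Rightarrow> 'k set \<Rightarrow> nat \<Rightarrow> 'k set" where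
  "step_down_sets n \<alpha>0 X C0 0 = C0"
| "step_down_sets n \<alpha>0 X C0 (Suc j) =
     {k \<in> step_down_sets n \<alpha>0 X C0 j.
        \<bar>sample_mean n X $ k\<bar> \<le> resampling_quantile n \<alpha>0 X (step_down_sets n \<alpha>0 X C0 j)}"

text \<open>
  The minimum exists, because the sets are finite and decreasing in \<open>j\<close>.
\<close>

definition stopping_index :: "nat \<Rightarrow> real \<Rightarrow> (nat \<Rightarrow> real ^ 'k) \<Rightarrow> 'k set \<Rightarrow> nat" where
  "stopping_index n \<alpha>0 X C0 =
     (LEAST j. j \<ge> 1 \<and> step_down_sets n \<alpha>0 X C0 j = step_down_sets n \<alpha>0 X C0 (j - 1))"

definition rejected_hypotheses ::
    "nat \<Rightarrow> ('k::finite \<Rightarrow> real) \<Rightarrow> real \<Rightarrow> real \<Rightarrow> real \<Rightarrow> (nat \<Rightarrow> real ^ 'k) \<Rightarrow> 'k set" where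
  "rejected_hypotheses n \<sigma> \<alpha> \<alpha>0 \<delta> X =
     (let R0 = initial_rejections n \<sigma> \<alpha> \<alpha>0 \<delta> X; C0 = UNIV - R0
      in if R0 = UNIV then UNIV
         else UNIV - step_down_sets n \<alpha>0 X C0 (stopping_index n \<alpha>0 X C0))"

end

theory Submission
  imports Defs
begin

text \<open>
  Let \<open>H = {k. \<mu>\<^sub>k = 0}\<close> be the set of true hypotheses and \<open>V\<^sup>i = Y\<^sup>i - \<mu>\<close>. A false rejection can
  only occur on one of two exceptional events, of probability at most \<open>\<alpha>\<^sub>0\<close> and \<open>\<alpha> - \<alpha>\<^sub>0\<close>.

  The first event is that the maximum over \<open>H\<close> of the absolute sample means of \<open>V\<close> exceeds
  \<open>q\<^sub>\<alpha>\<^sub>0(V, H)\<close>. Centered Gaussian vectors are symmetric and the \<open>V\<^sup>i\<close> are independent, so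
  multiplying the columns by fixed signs preserves their joint law, while the resampling quantile is
  invariant under such signs. Averaging over the signs bounds the probability by \<open>\<alpha>\<^sub>0\<close>
  (\<open>symmetric_resampling_level\<close>). Symmetry of the law of \<open>V\<^sup>i\<close> is known a priori only for its linear
  forms; passing to the whole vector is the uniqueness theorem for characteristic functions in
  several dimensions (\<open>char_uniqueness_euclidean\<close>), which is reduced to Levy's one-dimensional theorem.

  The second event is that some coordinate of the sample mean deviates from \<open>\<mu>\<close> by more than the
  Bonferroni threshold at level \<open>\<alpha> - \<alpha>\<^sub>0\<close>. A union bound over normal tails bounds it
  (\<open>bonf_threshold_coverage\<close>).

  Outside both events everything is deterministic. Passing from \<open>V\<close> to the empirically centered data
  changes a resampled mean by the mean of the signs times the estimation error, which the second
  event controls. Hence \<open>q\<^sub>\<alpha>\<^sub>0(V, H)\<close> is at most the threshold of the first step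
  (\<open>resampling_quantile_le_centered\<close>), and no element of \<open>H\<close> is rejected there. On \<open>H\<close> the matrices
  \<open>V\<close> and \<open>Y\<close> agree, and the quantile is monotone in the index set; so the sets of the second step,
  which contain \<open>H\<close> at the start, never lose an element of \<open>H\<close> (\<open>step_down_sets_retain\<close>).
\<close>

section \<open>Characteristic functions on Euclidean spaces\<close>

text \<open>
  Tilting a law by the density \<open>(2 + g) / c\<close> turns the bounded signed weight \<open>g\<close> into a probability
  measure. The constant 2 keeps the density positive and the total mass \<open>c\<close> at least 1.
\<close>

lemma (in prob_space) weighted_law:
  fixes Z g :: "'a \<Rightarrow> real"
  assumes [measurable]: "Z \<in> borel_measurable M" "g \<in> borel_measurable M"
    and g: "\<And>x. \<bar>g x\<bar> \<le> 1"
    and [measurable]: "A \<in> sets borel"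
  defines "c \<equiv> expectation (\<lambda>x. 2 + g x)"
  defines "D \<equiv> distr (density M (\<lambda>x. ennreal ((2 + g x) / c))) borel Z"
  shows "c \<ge> 1"
    and "complex_of_real c = 2 + (CLINT x|M. complex_of_real (g x))"
    and "real_distribution D"
    and "char D t =
      (2 * (CLINT x|M. iexp (t * Z x)) + (CLINT x|M. complex_of_real (g x) * iexp (t * Z x))) / c"
    and "measure D A =
      (2 * measure (distr M borel Z) A + (LINT x|M. g x * indicator A (Z x))) / c"
proof -
  have ig: "integrable M g" by (rule integrable_const_bound[where B=1]) (use g in auto)
  have "(LINT x|M. 1) \<le> (LINT x|M. 2 + g x)"
  proof (rule integral_mono)
    show "1 \<le> 2 + g x" for x using g[of x] by linarith
  qed (use ig in auto)
  then show c1: "c \<ge> 1" using prob_space by (simp add: c_def)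
  show "complex_of_real c = 2 + (CLINT x|M. complex_of_real (g x))"
    unfolding c_def using ig prob_space by simp
  have nn: "0 \<le> (2 + g x) / c" for x
    using g[of x] c1 by (intro divide_nonneg_nonneg) linarith+
  have "emeasure (density M (\<lambda>x. ennreal ((2 + g x) / c))) (space M) =
      (\<integral>\<^sup>+x. ennreal ((2 + g x) / c) \<partial>M)"
    by (subst emeasure_density) (auto intro!: nn_integral_cong simp: indicator_def)
  also have "\<dots> = ennreal (LINT x|M. (2 + g x) / c)"
    by (rule nn_integral_eq_integral) (use ig nn in auto)
  also have "(LINT x|M. (2 + g x) / c) = 1"
    using c1 unfolding integral_divide_zero c_def[symmetric] by simp
  finally interpret T: prob_space "density M (\<lambda>x. ennreal ((2 + g x) / c))"
    by (intro prob_spaceI) simp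
  show "real_distribution D"
    unfolding D_def real_distribution_def real_distribution_axioms_def
    by (auto intro!: T.prob_space_distr)
  have i1: "integrable M (\<lambda>x. iexp (t * Z x))"
    by (rule integrable_const_bound[where B=1]) auto
  have i2: "integrable M (\<lambda>x. complex_of_real (g x) * iexp (t * Z x))"
    by (rule integrable_const_bound[where B=1]) (use g in \<open>auto simp: norm_mult\<close>)
  have "char D t = (CLINT x|density M (\<lambda>x. ennreal ((2 + g x) / c)). iexp (t * Z x))"
    unfolding char_def D_def by (rule integral_distr) auto
  also have "\<dots> = (CLINT x|M. ((2 + g x) / c) *\<^sub>R iexp (t * Z x))"
    by (rule integral_density) (use nn in auto)
  also have "\<dots> = (CLINT x|M. (2 * iexp (t * Z x) + complex_of_real (g x) * iexp (t * Z x)) / c)"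
    by (rule Bochner_Integration.integral_cong)
      (auto simp: scaleR_conv_of_real field_simps add_divide_distrib)
  finally show "char D t =
      (2 * (CLINT x|M. iexp (t * Z x)) + (CLINT x|M. complex_of_real (g x) * iexp (t * Z x))) / c"
    using i1 i2 by simp
  have iA: "integrable M (\<lambda>x. indicator A (Z x) :: real)"
    by (rule integrable_const_bound[where B=1]) auto
  have igA: "integrable M (\<lambda>x. g x * indicator A (Z x))"
    by (rule integrable_const_bound[where B=1]) (use g in \<open>auto simp: indicator_def\<close>)
  have "measure D A = (LINT x|D. indicator A x)" by (simp add: D_def)
  also have "\<dots> = (LINT x|density M (\<lambda>x. ennreal ((2 + g x) / c)). indicator A (Z x))"
    unfolding D_def by (rule integral_distr) auto
  also have "\<dots> = (LINT x|M. ((2 + g x) / c) *\<^sub>R indicator A (Z x))"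
    by (rule integral_density) (use nn in auto)
  also have "\<dots> = (LINT x|M. (2 * indicator A (Z x) + g x * indicator A (Z x)) / c)"
    by (rule Bochner_Integration.integral_cong) (auto simp: field_simps)
  also have "\<dots> = (2 * (LINT x|M. indicator A (Z x)) + (LINT x|M. g x * indicator A (Z x))) / c"
    using iA igA by simp
  also have "(LINT x|M. indicator A (Z x)) = (LINT x|distr M borel Z. (indicator A x :: real))"
    by (rule integral_distr[symmetric]) auto
  finally show "measure D A =
      (2 * measure (distr M borel Z) A + (LINT x|M. g x * indicator A (Z x))) / c"
    by simp
qed

text \<open>
  The tilted laws of \<open>weighted_law\<close> have equal characteristic functions, hence coincide by Levy's
  theorem for probability measures; so do the laws of \<open>X\<close> and \<open>X'\<close>. Subtracting the two identities
  leaves the one for the signed weights.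
\<close>

lemma weighted_char_uniqueness:
  fixes X :: "'a \<Rightarrow> real" and X' :: "'b \<Rightarrow> real"
  assumes M: "prob_space M" and N: "prob_space N"
    and X[measurable]: "X \<in> borel_measurable M" and X'[measurable]: "X' \<in> borel_measurable N"
    and hM: "h \<in> borel_measurable M" and hN: "h' \<in> borel_measurable N"
    and h: "\<And>x. \<bar>h x\<bar> \<le> 1" and h': "\<And>x. \<bar>h' x\<bar> \<le> 1"
    and char: "\<And>t. (CLINT x|M. iexp (t * X x)) = (CLINT x|N. iexp (t * X' x))"
    and weighted: "\<And>t. (CLINT x|M. complex_of_real (h x) * iexp (t * X x)) =
                        (CLINT x|N. complex_of_real (h' x) * iexp (t * X' x))"
    and A: "A \<in> sets borel"
  shows "(LINT x|M. h x * indicator A (X x)) = (LINT x|N. h' x * indicator A (X' x))"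
proof -
  interpret M: prob_space M by fact
  interpret N: prob_space N by fact
  define c where "c = (LINT x|M. 2 + h x)"
  define d where "d = (LINT x|N. 2 + h' x)"
  define D where "D = distr (density M (\<lambda>x. ennreal ((2 + h x) / c))) borel X"
  define D' where "D' = distr (density N (\<lambda>x. ennreal ((2 + h' x) / d))) borel X'"
  note m = M.weighted_law[OF X hM h A, folded c_def, folded D_def]
  note n = N.weighted_law[OF X' hN h' A, folded d_def, folded D'_def]
  have "(CLINT x|M. complex_of_real (h x)) = (CLINT x|N. complex_of_real (h' x))"
    using weighted[of 0] by simp
  then have "complex_of_real c = complex_of_real d" unfolding m(2) n(2) by simp
  then have cd: "c = d" by (simp only: of_real_eq_iff)
  have plain: "distr M borel X = distr N borel X'"
  proof (rule Levy_uniqueness)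
    show "char (distr M borel X) = char (distr N borel X')"
      unfolding char_def by (subst (1 2) integral_distr) (use char in auto)
  qed (auto simp: real_distribution_def real_distribution_axioms_def
        intro!: M.prob_space_distr N.prob_space_distr)
  have "D = D'"
    by (rule Levy_uniqueness[OF m(3) n(3)]) (simp only: fun_eq_iff m(4) n(4) char weighted cd simp_thms)
  then have "(2 * measure (distr M borel X) A + (LINT x|M. h x * indicator A (X x))) / c =
      (2 * measure (distr N borel X') A + (LINT x|N. h' x * indicator A (X' x))) / d"
    using m(5) n(5) by simp
  then show ?thesis using plain cd m(1) by (simp add: field_simps)
qed

text \<open>
  The indicators are inserted one coordinate at a time. With the indicators of \<open>B\<close> already in
  place, their product times the cosine or the sine of \<open>t \<bullet> x\<close> serves as the weight \<open>h\<close> of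
  \<open>weighted_char_uniqueness\<close> for the law of the coordinate \<open>x \<bullet> b\<close>. The frequency \<open>t\<close> stays
  arbitrary, because the induction step calls the hypothesis at \<open>t + s b\<close> and \<open>- t + s b\<close>.
\<close>

lemma char_uniqueness_cylinder:
  fixes M N :: "'a::euclidean_space measure"
  assumes M: "prob_space M" and N: "prob_space N"
    and sM[measurable_cong]: "sets M = sets borel" and sN[measurable_cong]: "sets N = sets borel"
    and char: "\<And>t. (CLINT x|M. iexp (t \<bullet> x)) = (CLINT x|N. iexp (t \<bullet> x))"
    and A: "\<And>b. A b \<in> sets borel"
    and "finite B"
  shows "(CLINT x|M. complex_of_real (\<Prod>b\<in>B. indicator (A b) (x \<bullet> b)) * iexp (t \<bullet> x)) =
         (CLINT x|N. complex_of_real (\<Prod>b\<in>B. indicator (A b) (x \<bullet> b)) * iexp (t \<bullet> x))"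
  using \<open>finite B\<close>
proof (induction B arbitrary: t rule: finite_induct)
  case empty
  then show ?case using char by simp
next
  case (insert b B)
  interpret M: prob_space M by fact
  interpret N: prob_space N by fact
  note A[measurable]
  define g where "g x = (\<Prod>b\<in>B. indicator (A b) (x \<bullet> b) :: real)" for x
  have [measurable]: "g \<in> borel_measurable borel" unfolding g_def by measurable
  have g01: "0 \<le> g x" "g x \<le> 1" for x
    unfolding g_def by (auto intro!: prod_nonneg prod_le_1 simp: indicator_def)
  have IH: "(CLINT x|M. complex_of_real (g x) * iexp (t \<bullet> x))
      = (CLINT x|N. complex_of_real (g x) * iexp (t \<bullet> x))" for t
    using insert.IH unfolding g_def .
  have i: "integrable M (\<lambda>x. complex_of_real (g x) * iexp (t \<bullet> x))"
      "integrable N (\<lambda>x. complex_of_real (g x) * iexp (t \<bullet> x))" for t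
    by (rule M.integrable_const_bound[where B=1] N.integrable_const_bound[where B=1],
        use g01 in \<open>auto simp: norm_mult\<close>)+
  have gb: "\<bar>g x * cos (t \<bullet> x)\<bar> \<le> 1" "\<bar>g x * sin (t \<bullet> x)\<bar> \<le> 1" for x
    using g01[of x] by (auto simp: abs_mult intro!: mult_le_one)
  have ch: "(CLINT x|M. iexp (s * (x \<bullet> b))) = (CLINT x|N. iexp (s * (x \<bullet> b)))" for s
    using char[of "s *\<^sub>R b"] by (simp add: inner_commute)
  have iexp_shift: "iexp ((u + s *\<^sub>R b) \<bullet> x) = iexp (u \<bullet> x) * iexp (s * (x \<bullet> b))" for u s x
    by (simp add: inner_add_left inner_commute[of x b] distrib_left flip: exp_add)
  have cosine: "complex_of_real (g x * cos (t \<bullet> x)) * iexp (s * (x \<bullet> b)) =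
      (complex_of_real (g x) * iexp ((t + s *\<^sub>R b) \<bullet> x)
        + complex_of_real (g x) * iexp ((- t + s *\<^sub>R b) \<bullet> x)) / 2" for s x
  proof -
    have "complex_of_real (cos (t \<bullet> x)) = (iexp (t \<bullet> x) + iexp (- (t \<bullet> x))) / 2"
      by (simp add: cos_exp_eq flip: cos_of_real)
    then show ?thesis
      unfolding of_real_mult[of "g x"] iexp_shift iexp_shift[of "- t", unfolded inner_minus_left]
      by (simp only:) (simp add: field_simps)
  qed
  have sine: "complex_of_real (g x * sin (t \<bullet> x)) * iexp (s * (x \<bullet> b)) =
      (complex_of_real (g x) * iexp ((t + s *\<^sub>R b) \<bullet> x)
        - complex_of_real (g x) * iexp ((- t + s *\<^sub>R b) \<bullet> x)) / (2 * \<i>)" for s x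
  proof -
    have "complex_of_real (sin (t \<bullet> x)) = (iexp (t \<bullet> x) - iexp (- (t \<bullet> x))) / (2 * \<i>)"
      by (simp add: sin_exp_eq flip: sin_of_real)
    then show ?thesis
      unfolding of_real_mult[of "g x"] iexp_shift iexp_shift[of "- t", unfolded inner_minus_left]
      by (simp only:) (simp add: field_simps)
  qed
  have C: "(LINT x|M. g x * cos (t \<bullet> x) * indicator (A b) (x \<bullet> b))
      = (LINT x|N. g x * cos (t \<bullet> x) * indicator (A b) (x \<bullet> b))"
    by (rule weighted_char_uniqueness[OF M N _ _ _ _ gb(1) gb(1) ch])
      (use i in \<open>simp_all only: cosine, simp_all add: IH\<close>)
  have S: "(LINT x|M. g x * sin (t \<bullet> x) * indicator (A b) (x \<bullet> b))
      = (LINT x|N. g x * sin (t \<bullet> x) * indicator (A b) (x \<bullet> b))"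
    by (rule weighted_char_uniqueness[OF M N _ _ _ _ gb(2) gb(2) ch])
      (use i in \<open>simp_all only: sine, simp_all add: IH\<close>)
  have split: "(CLINT x|L. complex_of_real (\<Prod>b\<in>insert b B. indicator (A b) (x \<bullet> b)) * iexp (t \<bullet> x)) =
     complex_of_real (LINT x|L. g x * cos (t \<bullet> x) * indicator (A b) (x \<bullet> b))
         + \<i> * complex_of_real (LINT x|L. g x * sin (t \<bullet> x) * indicator (A b) (x \<bullet> b))"
    if L: "prob_space L" and [measurable_cong]: "sets L = sets borel" for L
  proof -
    interpret L: prob_space L by fact
    have ii: "integrable L (\<lambda>x. g x * cos (t \<bullet> x) * indicator (A b) (x \<bullet> b))"
        "integrable L (\<lambda>x. g x * sin (t \<bullet> x) * indicator (A b) (x \<bullet> b))"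
      by (rule L.integrable_const_bound[where B=1], use gb in \<open>auto simp: indicator_def\<close>)+
    have "(CLINT x|L. complex_of_real (\<Prod>b\<in>insert b B. indicator (A b) (x \<bullet> b)) * iexp (t \<bullet> x)) =
      (CLINT x|L. complex_of_real (g x * cos (t \<bullet> x) * indicator (A b) (x \<bullet> b))
          + \<i> * complex_of_real (g x * sin (t \<bullet> x) * indicator (A b) (x \<bullet> b)))"
      by (rule Bochner_Integration.integral_cong)
        (use insert.hyps in \<open>auto simp: g_def cis_conv_exp[symmetric] complex_eq_iff indicator_def\<close>)
    also have "\<dots> = (CLINT x|L. complex_of_real (g x * cos (t \<bullet> x) * indicator (A b) (x \<bullet> b)))
        + (CLINT x|L. \<i> * complex_of_real (g x * sin (t \<bullet> x) * indicator (A b) (x \<bullet> b)))"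
      using ii by (intro Bochner_Integration.integral_add integrable_mult_right integrable_of_real)
    finally show ?thesis by (simp only: integral_mult_right_zero integral_complex_of_real)
  qed
  show ?case unfolding split[OF M sM] split[OF N sN] C S ..
qed

text \<open>
  At frequency 0 the preceding lemma gives the measures of boxes, and boxes generate the Borel sets.
\<close>

theorem char_uniqueness_euclidean:
  fixes M N :: "'a::euclidean_space measure"
  assumes M: "prob_space M" and N: "prob_space N"
    and sM: "sets M = sets borel" and sN: "sets N = sets borel"
    and char: "\<And>t. (CLINT x|M. iexp (t \<bullet> x)) = (CLINT x|N. iexp (t \<bullet> x))"
  shows "M = N"
proof -
  interpret M: prob_space M by fact
  interpret N: prob_space N by fact
  have box: "emeasure M (box a b) = emeasure N (box a b)" for a b :: 'a
  proof -
    have e: "(\<Prod>i\<in>Basis. indicator {a \<bullet> i<..<b \<bullet> i} (x \<bullet> i) :: real) = indicator (box a b) x" for x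
      by (auto simp: indicator_def box_def)
    have "(CLINT x|M. complex_of_real (indicator (box a b) x))
        = (CLINT x|N. complex_of_real (indicator (box a b) x))"
      using char_uniqueness_cylinder[OF M N sM sN char, of "\<lambda>i. {a \<bullet> i<..<b \<bullet> i}" Basis 0]
      unfolding e by simp
    then have "(LINT x|M. indicator (box a b) x :: real) = (LINT x|N. indicator (box a b) x)"
      by (simp only: integral_complex_of_real of_real_eq_iff)
    then show ?thesis
      using sM sN by (simp add: M.emeasure_eq_measure N.emeasure_eq_measure
          sets_eq_imp_space_eq[OF sM] sets_eq_imp_space_eq[OF sN])
  qed
  have bor: "sets (borel::'a measure) = sigma_sets UNIV (range (\<lambda>(a,b). box a b))"
    by (simp add: borel_eq_box)
  show ?thesis
  proof (rule measure_eqI_generator_eq[where E="range (\<lambda>(a,b). box a b :: 'a set)" and \<Omega>=UNIV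
        and A="\<lambda>n. box (- (real n *\<^sub>R One)) (real n *\<^sub>R One)"])
    show "Int_stable (range (\<lambda>(a,b). box a b :: 'a set))"
      by (auto simp: Int_stable_def box_Int_box)
    show "(\<Union>i. box (- (real i *\<^sub>R One)) (real i *\<^sub>R One)) = (UNIV :: 'a set)"
      by (rule UN_box_eq_UNIV)
  qed (use box sM sN bor in auto)
qed

section \<open>Resampling quantiles and Rademacher signs\<close>

text \<open>
  The statistic whose conditional quantile is \<open>resampling_quantile\<close>. With all weights equal to 1 it
  is the maximum of the absolute sample means over \<open>C\<close>.
\<close>

definition resampled_sup :: "nat \<Rightarrow> 'k set \<Rightarrow> (nat \<Rightarrow> real) \<Rightarrow> (nat \<Rightarrow> real ^ 'k) \<Rightarrow> real" where
  "resampled_sup n C w X = (SUP k\<in>C. \<bar>1 / real n * (\<Sum>i=1..n. w i * X i $ k)\<bar>)"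

lemma resampled_sup_le_iff:
  fixes C :: "'k::finite set"
  assumes "C \<noteq> {}"
  shows "resampled_sup n C w X \<le> x \<longleftrightarrow> (\<forall>k\<in>C. \<bar>1 / real n * (\<Sum>i=1..n. w i * X i $ k)\<bar> \<le> x)"
  unfolding resampled_sup_def using assms by (intro cSUP_le_iff) auto

lemma resampled_sup_signs:
  "resampled_sup n C w (\<lambda>i. s i *\<^sub>R X i) = resampled_sup n C (\<lambda>i. s i * w i) X"
  by (simp add: resampled_sup_def mult_ac)

text \<open>
  The defining infimum is attained since distribution functions are right-continuous: the quantile is
  the generalised inverse of the distribution function of the resampled statistic at \<open>1 - \<eta>\<close>.
\<close>

lemma resampling_quantile_le_iff:
  assumes "0 < \<eta>" "\<eta> < 1"
  shows "resampling_quantile n \<eta> X C \<le> x \<longleftrightarrow>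
    measure_pmf.prob (rademacher_signs n) {w. resampled_sup n C w X > x} \<le> \<eta>"
proof -
  let ?P = "measure_pmf (rademacher_signs n)"
  interpret cdf_distribution "distr ?P borel (\<lambda>w. resampled_sup n C w X)"
    unfolding cdf_distribution_def real_distribution_def real_distribution_axioms_def
    by (auto intro!: measure_pmf.prob_space_distr)
  have tail: "cdf (distr ?P borel (\<lambda>w. resampled_sup n C w X)) y =
      1 - measure_pmf.prob (rademacher_signs n) {w. resampled_sup n C w X > y}" for y
  proof -
    have "cdf (distr ?P borel (\<lambda>w. resampled_sup n C w X)) y =
        measure_pmf.prob (rademacher_signs n) {w. resampled_sup n C w X \<le> y}"
      by (auto simp: cdf_def measure_distr vimage_def)
    also have "\<dots> = 1 - measure_pmf.prob (rademacher_signs n) (UNIV - {w. resampled_sup n C w X \<le> y})"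
      by (subst measure_pmf.prob_compl[of _ "rademacher_signs n", simplified]) auto
    also have "UNIV - {w. resampled_sup n C w X \<le> y} = {w. resampled_sup n C w X > y}" by auto
    finally show ?thesis .
  qed
  have "{y. measure_pmf.prob (rademacher_signs n) {w. resampled_sup n C w X > y} \<le> \<eta>} =
      {y. 1 - \<eta> \<le> cdf (distr ?P borel (\<lambda>w. resampled_sup n C w X)) y}"
    by (auto simp: tail)
  then show ?thesis
    using pseudoinverse[of "1 - \<eta>" x] assms
    unfolding resampling_quantile_def resampled_sup_def[symmetric] by (simp add: tail)
qed

lemma resampling_quantile_mono:
  fixes C :: "'k::finite set"
  assumes "0 < \<eta>" "\<eta> < 1" "C \<noteq> {}" "C \<subseteq> C'"
  shows "resampling_quantile n \<eta> X C \<le> resampling_quantile n \<eta> X C'"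
proof -
  have "measure_pmf.prob (rademacher_signs n) {w. resampled_sup n C w X > resampling_quantile n \<eta> X C'}
      \<le> measure_pmf.prob (rademacher_signs n) {w. resampled_sup n C' w X > resampling_quantile n \<eta> X C'}"
  proof (intro measure_pmf.finite_measure_mono subsetI CollectI)
    fix w assume "w \<in> {w. resampled_sup n C w X > resampling_quantile n \<eta> X C'}"
    then show "resampled_sup n C' w X > resampling_quantile n \<eta> X C'"
      using assms resampled_sup_le_iff[of C n w X] resampled_sup_le_iff[of C' n w X]
      by (auto simp flip: not_le)
  qed auto
  also have "\<dots> \<le> \<eta>"
    using resampling_quantile_le_iff[OF assms(1,2), of n X C' "resampling_quantile n \<eta> X C'"] by simp
  finally show ?thesis using resampling_quantile_le_iff[OF assms(1,2)] by blast
qed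

lemma rademacher_signs_uniform:
  "rademacher_signs n = pmf_of_set (PiE_dflt {1..n} 0 (\<lambda>_. {-1, 1}))"
  unfolding rademacher_signs_def by (rule Pi_pmf_of_set) auto

lemma set_rademacher_signs: "set_pmf (rademacher_signs n) = PiE_dflt {1..n} 0 (\<lambda>_. {-1, 1})"
  unfolding rademacher_signs_uniform by (rule set_pmf_of_set) (auto simp: finite_PiE_dflt)

lemma finite_set_rademacher_signs [simp]: "finite (set_pmf (rademacher_signs n))"
  unfolding set_rademacher_signs by (auto simp: finite_PiE_dflt)

text \<open>
  The sign vector is uniform on a finite set which every coordinatewise sign change permutes.
\<close>

lemma rademacher_signs_sign_invariant:
  assumes s: "\<And>i. i \<in> {1..n} \<Longrightarrow> s i \<in> {-1, 1}"
  shows "map_pmf (\<lambda>w i. s i * w i) (rademacher_signs n) = rademacher_signs n"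
proof -
  let ?S = "PiE_dflt {1..n} 0 (\<lambda>_. {-1, 1 :: real})"
  have ss: "s i * (s i * x) = x" if "i \<in> {1..n}" for i x using s[OF that] by auto
  have cl: "(\<lambda>i. s i * w i) \<in> ?S" if "w \<in> ?S" for w
    using that s by (fastforce simp: PiE_dflt_def)
  have inv: "(\<lambda>i. s i * (s i * w i)) = w" if "w \<in> ?S" for w
  proof
    show "s i * (s i * w i) = w i" for i using that ss[of i]
        by (cases "i \<in> {1..n}") (auto simp: PiE_dflt_def)
  qed
  have "bij_betw (\<lambda>w i. s i * w i) ?S ?S"
    by (rule bij_betw_byWitness[where f'="\<lambda>w i. s i * w i"]) (use cl inv in auto)
  then show ?thesis
    unfolding rademacher_signs_uniform by (rule map_pmf_of_set_bij_betw) (auto simp: finite_PiE_dflt)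
qed

lemma rademacher_prob_signs:
  assumes s: "\<And>i. i \<in> {1..n} \<Longrightarrow> s i \<in> {-1, 1}"
  shows "measure_pmf.prob (rademacher_signs n) {w. P (\<lambda>i. s i * w i)} =
         measure_pmf.prob (rademacher_signs n) {w. P w}"
  by (subst (2) rademacher_signs_sign_invariant[OF s, symmetric]) (simp_all add: vimage_def)

lemma resampling_quantile_signs:
  assumes s: "\<And>i. i \<in> {1..n} \<Longrightarrow> s i \<in> {-1, 1}"
  shows "resampling_quantile n \<eta> (\<lambda>i. s i *\<^sub>R X i) C = resampling_quantile n \<eta> X C"
  unfolding resampling_quantile_def resampled_sup_def[symmetric] resampled_sup_signs
  by (subst rademacher_prob_signs[OF s]) auto

text \<open>
  A sum of \<open>n\<close> signs is \<open>2 B - n\<close>, where \<open>B\<close> counts the positive signs and is binomial.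
\<close>

lemma rademacher_sum_tail:
  "measure_pmf.prob (rademacher_signs n) {w. (\<Sum>i=1..n. w i) > 2 * real m - real n} =
   (\<Sum>i=Suc m..n. real (n choose i)) / 2 ^ n"
proof -
  let ?c = "\<lambda>f i. if i \<in> {1..n} then (if f i then 1 else -1 :: real) else 0"
  let ?B = "Pi_pmf {1..n} False (\<lambda>_. bernoulli_pmf (1/2))"
  \<comment> \<open>Signs are images of fair coin flips. The default value outside the index set has to be exchanged
    separately, as no coin value is mapped to 0.\<close>
  have coin: "pmf_of_set {-1, 1 :: real} = map_pmf (\<lambda>b. if b then 1 else -1) (bernoulli_pmf (1/2))"
    unfolding bernoulli_pmf_half_conv_pmf_of_set
    by (subst map_pmf_of_set_inj) (auto simp: inj_on_def UNIV_bool)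
  have "rademacher_signs n = map_pmf (\<lambda>f x. if x \<in> {1..n} then f x else 0)
          (Pi_pmf {1..n} (-1) (\<lambda>_. pmf_of_set {-1, 1}))"
    unfolding rademacher_signs_def by (rule Pi_pmf_default_swap[symmetric]) simp
  also have "Pi_pmf {1..n} (-1) (\<lambda>_. pmf_of_set {-1, 1 :: real})
      = map_pmf (\<lambda>h. (\<lambda>b. if b then 1 else -1) \<circ> h) ?B"
    unfolding coin by (rule Pi_pmf_map) auto
  finally have rad: "rademacher_signs n = map_pmf ?c ?B" by (simp add: pmf.map_comp o_def)
  have count: "(\<Sum>i=1..n. ?c f i) = 2 * real (card {i\<in>{1..n}. f i}) - real n" for f
  proof -
    have "(\<Sum>i=1..n. ?c f i) = (\<Sum>i=1..n. 2 * (if f i then 1 else 0) - 1)" by (intro sum.cong) auto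
    also have "\<dots> = 2 * (\<Sum>i=1..n. if f i then 1 else 0) - real n"
        by (simp add: sum_subtractf sum_distrib_left)
    also have "(\<Sum>i=1..n. if f i then 1 else 0 :: real) = real (card {i\<in>{1..n}. f i})"
      by (simp flip: sum.inter_filter)
    finally show ?thesis .
  qed
  have "measure_pmf.prob (rademacher_signs n) {w. (\<Sum>i=1..n. w i) > 2 * real m - real n} =
      measure_pmf.prob ?B {f. card {i\<in>{1..n}. f i} > m}"
    unfolding rad measure_map_pmf vimage_def mem_Collect_eq count by simp
  also have "\<dots> = measure_pmf.prob (map_pmf (\<lambda>f. card {i\<in>{1..n}. f i}) ?B) {m<..}"
    by (simp add: vimage_def)
  also have "map_pmf (\<lambda>f. card {i\<in>{1..n}. f i}) ?B = binomial_pmf n (1/2)"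
    by (rule binomial_pmf_altdef'[symmetric]) auto
  also have "measure_pmf.prob (binomial_pmf n (1/2)) {m<..}
      = measure_pmf.prob (binomial_pmf n (1/2)) {Suc m..n}"
    by (intro measure_pmf.finite_measure_eq_AE) (auto simp: AE_measure_pmf_iff set_pmf_binomial_eq)
  also have "\<dots> = (\<Sum>i=Suc m..n. real (n choose i) * (1/2) ^ i * (1/2) ^ (n - i))"
    by (subst measure_measure_pmf_finite) auto
  also have "\<dots> = (\<Sum>i=Suc m..n. real (n choose i) / 2 ^ n)"
    by (intro sum.cong) (auto simp: field_simps simp flip: power_add)
  finally show ?thesis by (simp add: sum_divide_distrib)
qed

text \<open>
  The factor \<open>\<gamma>\<^sub>n(\<eta>)\<close> is chosen so that each of the two one-sided tails has probability below
  \<open>\<eta> / 2\<close>: no index beyond the binomial quantile \<open>m\<close> has upper tail at least \<open>\<eta> / 2\<close>, and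
  exceeding \<open>\<gamma>\<^sub>n(\<eta>)\<close> means having at least \<open>m + 1\<close> positive signs.
\<close>

lemma rademacher_mean_tail:
  assumes n: "n \<ge> 1" and \<eta>: "0 < \<eta>"
  shows "measure_pmf.prob (rademacher_signs n)
      {w. \<bar>1 / real n * (\<Sum>i=1..n. w i)\<bar> > gamma_factor n \<eta>} \<le> \<eta>"
proof -
  define m where "m = binom_upper_quantile n (\<eta> / 2)"
  let ?K = "{k \<in> {0..n}. (\<Sum>i=k..n. real (n choose i)) / 2 ^ n \<ge> \<eta> / 2}"
  have m: "m = Max ?K" by (simp add: m_def binom_upper_quantile_def)
  have tail: "(\<Sum>i=Suc m..n. real (n choose i)) / 2 ^ n \<le> \<eta> / 2"
  proof (rule ccontr)
    assume *: "\<not> ?thesis"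
    then have "Suc m \<le> n" using \<eta> by (cases "Suc m \<le> n") auto
    with * have "Suc m \<in> ?K" by simp
    from Max_ge[OF _ this] m show False by simp
  qed
  have g: "gamma_factor n \<eta> < x / real n \<longleftrightarrow> x > 2 * real m - real n" for x
    using n by (simp add: gamma_factor_def m_def divide_less_cancel)
  have one: "measure_pmf.prob (rademacher_signs n) {w. 1 / real n * (\<Sum>i=1..n. w i) > gamma_factor n \<eta>}
      \<le> \<eta> / 2"
    using tail rademacher_sum_tail[of n m] by (simp add: g)
  have two: "measure_pmf.prob (rademacher_signs n) {w. - (1 / real n * (\<Sum>i=1..n. w i))
      > gamma_factor n \<eta>} \<le> \<eta> / 2"
    using one rademacher_prob_signs[of n "\<lambda>_. -1" "\<lambda>w. 1 / real n * (\<Sum>i=1..n. w i) > gamma_factor n \<eta>"]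
    by (simp add: sum_negf)
  have "measure_pmf.prob (rademacher_signs n) {w. \<bar>1 / real n * (\<Sum>i=1..n. w i)\<bar> > gamma_factor n \<eta>}
    \<le> measure_pmf.prob (rademacher_signs n) ({w. 1 / real n * (\<Sum>i=1..n. w i) > gamma_factor n \<eta>} \<union>
        {w. - (1 / real n * (\<Sum>i=1..n. w i)) > gamma_factor n \<eta>})"
    by (intro measure_pmf.finite_measure_mono) auto
  also have "\<dots> \<le> \<eta> / 2 + \<eta> / 2"
    by (rule order_trans[OF measure_Un_le]) (use one two in auto)
  finally show ?thesis by simp
qed

text \<open>
  Centering by the unknown mean instead of the empirical one shifts each resampled mean by the mean
  of the signs times the estimation error. Outside an event of sign probability at most \<open>\<eta>\<^sub>2\<close> the
  first factor is bounded by \<open>\<gamma>\<^sub>n(\<eta>\<^sub>2)\<close>, and \<open>t\<close> bounds the second. Here \<open>X\<close> is deterministic and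
  only the signs are random.
\<close>

lemma resampling_quantile_le_centered:
  fixes X :: "nat \<Rightarrow> real ^ 'k::finite"
  assumes n: "n \<ge> 1" and \<eta>: "0 < \<eta>\<^sub>1" "\<eta>\<^sub>1 < 1" "0 < \<eta>\<^sub>2" "\<eta>\<^sub>1 + \<eta>\<^sub>2 < 1"
    and t: "\<And>k. \<bar>sample_mean n X $ k - \<mu> $ k\<bar> \<le> t"
    and C: "C \<noteq> {}"
  shows "resampling_quantile n (\<eta>\<^sub>1 + \<eta>\<^sub>2) (\<lambda>i. X i - \<mu>) C \<le>
    resampling_quantile n \<eta>\<^sub>1 (centered n X) UNIV + gamma_factor n \<eta>\<^sub>2 * t"
proof -
  let ?P = "measure_pmf.prob (rademacher_signs n)"
  let ?q = "resampling_quantile n \<eta>\<^sub>1 (centered n X) UNIV" and ?g = "gamma_factor n \<eta>\<^sub>2"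
  have sub: "{w. resampled_sup n C w (\<lambda>i. X i - \<mu>) > ?q + ?g * t} \<subseteq>
      {w. resampled_sup n UNIV w (centered n X) > ?q} \<union> {w. \<bar>1 / real n * (\<Sum>i=1..n. w i)\<bar> > ?g}"
  proof (rule subsetI, rule ccontr)
    fix w assume w: "w \<in> {w. resampled_sup n C w (\<lambda>i. X i - \<mu>) > ?q + ?g * t}"
      and "w \<notin> {w. resampled_sup n UNIV w (centered n X) > ?q} \<union> {w. \<bar>1 / real n * (\<Sum>i=1..n. w i)\<bar> > ?g}"
    then have a: "resampled_sup n UNIV w (centered n X) \<le> ?q" and b: "\<bar>1 / real n * (\<Sum>i=1..n. w i)\<bar>
        \<le> ?g" by auto
    have "resampled_sup n C w (\<lambda>i. X i - \<mu>) \<le> ?q + ?g * t"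
      unfolding resampled_sup_le_iff[OF C]
    proof
      fix k
      have "1 / real n * (\<Sum>i=1..n. w i * (X i - \<mu>) $ k) = 1 / real n * (\<Sum>i=1..n. w i * centered n X i $ k)
          + (1 / real n * (\<Sum>i=1..n. w i)) * (sample_mean n X $ k - \<mu> $ k)"
      proof -
        have "(\<Sum>i=1..n. w i * (X i - \<mu>) $ k) =
            (\<Sum>i=1..n. w i * centered n X i $ k + w i * (sample_mean n X $ k - \<mu> $ k))"
          by (intro sum.cong) (simp_all add: centered_def algebra_simps)
        also have "\<dots> = (\<Sum>i=1..n. w i * centered n X i $ k) + (\<Sum>i=1..n. w i) * (sample_mean n X $ k - \<mu> $ k)"
          by (simp add: sum.distrib sum_distrib_right)
        finally show ?thesis by (simp add: distrib_left)
      qed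
      also have "\<bar>\<dots>\<bar> \<le> \<bar>1 / real n * (\<Sum>i=1..n. w i * centered n X i $ k)\<bar>
          + \<bar>1 / real n * (\<Sum>i=1..n. w i)\<bar> * \<bar>sample_mean n X $ k - \<mu> $ k\<bar>"
        by (rule order_trans[OF abs_triangle_ineq]) (simp only: abs_mult order_refl)
      also have "\<dots> \<le> ?q + ?g * t"
      proof (intro add_mono mult_mono)
        show "\<bar>1 / real n * (\<Sum>i=1..n. w i * centered n X i $ k)\<bar> \<le> ?q"
          using a resampled_sup_le_iff[of UNIV n w "centered n X"] by blast
        show "0 \<le> ?g" using order_trans[OF abs_ge_zero b] .
      qed (use b t in auto)
      finally show "\<bar>1 / real n * (\<Sum>i=1..n. w i * (X i - \<mu>) $ k)\<bar> \<le> ?q + ?g * t" .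
    qed
    then show False using w by simp
  qed
  have "?P {w. resampled_sup n C w (\<lambda>i. X i - \<mu>) > ?q + ?g * t} \<le>
      ?P {w. resampled_sup n UNIV w (centered n X) > ?q} + ?P {w. \<bar>1 / real n * (\<Sum>i=1..n. w i)\<bar> > ?g}"
    by (rule order_trans[OF measure_pmf.finite_measure_mono[OF sub] measure_Un_le]) auto
  also have "\<dots> \<le> \<eta>\<^sub>1 + \<eta>\<^sub>2"
    using resampling_quantile_le_iff[OF \<eta>(1,2), of n "centered n X" UNIV ?q]
        rademacher_mean_tail[OF n \<eta>(3)]
    by (intro add_mono) auto
  finally show ?thesis using resampling_quantile_le_iff[of "\<eta>\<^sub>1 + \<eta>\<^sub>2"] \<eta> by auto
qed

text \<open>
  The quantile grows with the index set, so a set \<open>H\<close> that passes the test at its own threshold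
  passes it at the threshold of every larger set, and no iteration can remove any of its elements.
\<close>

lemma step_down_sets_retain:
  fixes X :: "nat \<Rightarrow> real ^ 'k::finite"
  assumes "0 < \<alpha>0" "\<alpha>0 < 1" "H \<noteq> {}" "H \<subseteq> C0"
    and H: "\<And>k. k \<in> H \<Longrightarrow> \<bar>sample_mean n X $ k\<bar> \<le> resampling_quantile n \<alpha>0 X H"
  shows "H \<subseteq> step_down_sets n \<alpha>0 X C0 j"
proof (induction j)
  case (Suc j)
  then have "resampling_quantile n \<alpha>0 X H \<le> resampling_quantile n \<alpha>0 X (step_down_sets n \<alpha>0 X C0 j)"
    using assms by (intro resampling_quantile_mono)
  with Suc H show ?case by fastforce
qed (use assms in simp)

section \<open>Measurability of the procedure\<close>

lemma borel_measurable_vec_component: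
  fixes Z :: "'b \<Rightarrow> real ^ 'k::finite"
  assumes [measurable]: "Z \<in> borel_measurable N"
  shows "(\<lambda>\<omega>. Z \<omega> $ k) \<in> borel_measurable N"
proof -
  have "(\<lambda>\<omega>. Z \<omega> \<bullet> axis k 1) \<in> borel_measurable N" by measurable
  then show ?thesis by (simp add: inner_axis)
qed

lemma resampled_sup_measurable:
  fixes X :: "'b \<Rightarrow> nat \<Rightarrow> real ^ 'k::finite"
  assumes "\<And>i. i \<in> {1..n} \<Longrightarrow> (\<lambda>\<omega>. X \<omega> i) \<in> borel_measurable N"
  shows "(\<lambda>\<omega>. resampled_sup n C w (X \<omega>)) \<in> borel_measurable N"
  unfolding resampled_sup_def
proof (rule borel_measurable_cSUP)
  fix k
  have [measurable]: "(\<lambda>\<omega>. X \<omega> i $ k) \<in> borel_measurable N" if "i \<in> {1..n}" for i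
    using assms[OF that] by (rule borel_measurable_vec_component)
  show "(\<lambda>\<omega>. \<bar>1 / real n * (\<Sum>i=1..n. w i * X \<omega> i $ k)\<bar>) \<in> borel_measurable N"
    by measurable
qed auto

lemma measure_pmf_finite_support:
  assumes "finite (set_pmf p)"
  shows "measure_pmf.prob p {w. P w} = (\<Sum>w\<in>set_pmf p. pmf p w * indicator {w. P w} w)"
proof -
  have "measure_pmf.prob p {w. P w} = (LINT w|measure_pmf p. indicator {w. P w} w)" by simp
  also have "\<dots> = (\<Sum>w\<in>set_pmf p. pmf p w *\<^sub>R indicator {w. P w} w)"
    by (rule integral_measure_pmf) (use assms in auto)
  finally show ?thesis by simp
qed

lemma resampling_quantile_measurable:
  fixes X :: "'b \<Rightarrow> nat \<Rightarrow> real ^ 'k::finite"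
  assumes X: "\<And>i. i \<in> {1..n} \<Longrightarrow> (\<lambda>\<omega>. X \<omega> i) \<in> borel_measurable N"
    and \<eta>: "0 < \<eta>" "\<eta> < 1"
  shows "(\<lambda>\<omega>. resampling_quantile n \<eta> (X \<omega>) C) \<in> borel_measurable N"
proof (rule borel_measurableI_le)
  fix y
  note resampled_sup_measurable[OF X, measurable]
  have "(\<lambda>\<omega>. measure_pmf.prob (rademacher_signs n) {w. resampled_sup n C w (X \<omega>) > y}) =
     (\<lambda>\<omega>. \<Sum>w\<in>set_pmf (rademacher_signs n). pmf (rademacher_signs n) w * indicator {\<omega>. resampled_sup n
         C w (X \<omega>) > y} \<omega>)"
    by (subst measure_pmf_finite_support) (auto simp: indicator_def)
  also have "\<dots> \<in> borel_measurable N"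
    by measurable
  finally show "{\<omega> \<in> space N. resampling_quantile n \<eta> (X \<omega>) C \<le> y} \<in> sets N"
    unfolding resampling_quantile_le_iff[OF \<eta>] by measurable
qed

text \<open>
  The sets of hypotheses produced by the procedure are treated as random elements of a finite,
  hence discrete, space.
\<close>

lemma measurable_Collect_finite:
  fixes P :: "'k::finite \<Rightarrow> 'b \<Rightarrow> bool"
  assumes [measurable]: "\<And>k. Measurable.pred N (P k)"
  shows "(\<lambda>\<omega>. {k. P k \<omega>}) \<in> measurable N (count_space UNIV)"
proof (subst measurable_count_space_eq2_countable)
  have "{\<omega> \<in> space N. {k. P k \<omega>} = S} = {\<omega> \<in> space N. \<forall>k. P k \<omega> \<longleftrightarrow> k \<in> S}" for S
    by auto
  then have "{\<omega> \<in> space N. {k. P k \<omega>} = S} \<in> sets N" for S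
    by simp
  moreover have "(\<lambda>\<omega>. {k. P k \<omega>}) -` {S} \<inter> space N = {\<omega> \<in> space N. {k. P k \<omega>} = S}" for S
    by auto
  ultimately show "(\<lambda>\<omega>. {k. P k \<omega>}) \<in> space N \<rightarrow> UNIV \<and>
      (\<forall>S\<in>UNIV. (\<lambda>\<omega>. {k. P k \<omega>}) -` {S} \<inter> space N \<in> sets N)" by simp
qed

lemma sample_mean_measurable:
  fixes X :: "'b \<Rightarrow> nat \<Rightarrow> real ^ 'k::finite"
  assumes [measurable]: "\<And>i. i \<in> {1..n} \<Longrightarrow> (\<lambda>\<omega>. X \<omega> i) \<in> borel_measurable N"
  shows "(\<lambda>\<omega>. sample_mean n (X \<omega>)) \<in> borel_measurable N"
  unfolding sample_mean_def by measurable

lemma step_down_sets_measurable: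
  fixes X :: "'b \<Rightarrow> nat \<Rightarrow> real ^ 'k::finite"
  assumes X: "\<And>i. i \<in> {1..n} \<Longrightarrow> (\<lambda>\<omega>. X \<omega> i) \<in> borel_measurable N"
    and \<alpha>0: "0 < \<alpha>0" "\<alpha>0 < 1"
    and C0: "C0 \<in> measurable N (count_space UNIV)"
  shows "(\<lambda>\<omega>. step_down_sets n \<alpha>0 (X \<omega>) (C0 \<omega>) j) \<in> measurable N (count_space UNIV)"
proof (induction j)
  case 0
  then show ?case using C0 by simp
next
  case (Suc j)
  note resampling_quantile_measurable[OF X \<alpha>0, measurable]
    borel_measurable_vec_component[OF sample_mean_measurable[OF X], measurable]
  have "(\<lambda>\<omega>. {k. k \<in> S \<and> \<bar>sample_mean n (X \<omega>) $ k\<bar> \<le> resampling_quantile n \<alpha>0 (X \<omega>) S})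
      \<in> measurable N (count_space UNIV)" for S
    by (rule measurable_Collect_finite) measurable
  from measurable_compose_countable[OF this Suc] show ?case by simp
qed

lemma rejected_hypotheses_measurable:
  fixes X :: "'b \<Rightarrow> nat \<Rightarrow> real ^ 'k::finite"
  assumes X: "\<And>i. i \<in> {1..n} \<Longrightarrow> (\<lambda>\<omega>. X \<omega> i) \<in> borel_measurable N"
    and \<alpha>0: "0 < \<alpha>0" "\<alpha>0 < 1" and \<delta>: "0 < \<delta>" "\<delta> < 1"
  shows "(\<lambda>\<omega>. rejected_hypotheses n \<sigma> \<alpha> \<alpha>0 \<delta> (X \<omega>)) \<in> measurable N (count_space UNIV)"
proof -
  note borel_measurable_vec_component[OF sample_mean_measurable[OF X], measurable]
  have c: "(\<lambda>\<omega>. centered n (X \<omega>) i) \<in> borel_measurable N" if "i \<in> {1..n}" for i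
    unfolding centered_def using X[OF that] sample_mean_measurable[OF X] by measurable
  have "0 < \<alpha>0 * (1 - \<delta>)" "\<alpha>0 * (1 - \<delta>) < 1"
    using \<alpha>0 \<delta> mult_strict_mono[of \<alpha>0 1 "1 - \<delta>" 1] by auto
  note resampling_quantile_measurable[OF c this, measurable]
  define R0 where "R0 \<omega> = initial_rejections n \<sigma> \<alpha> \<alpha>0 \<delta> (X \<omega>)" for \<omega>
  define S where "S j \<omega> = step_down_sets n \<alpha>0 (X \<omega>) (UNIV - R0 \<omega>) j" for j \<omega>
  have R0: "R0 \<in> measurable N (count_space UNIV)"
    unfolding R0_def[abs_def] initial_rejections_def quant_bonf_threshold_def
    by (rule measurable_Collect_finite) measurable
  have S: "S j \<in> measurable N (count_space UNIV)" for j
    unfolding S_def by (rule step_down_sets_measurable[OF X \<alpha>0]) (auto intro: measurable_compose[OF R0])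
  have "Measurable.pred N (\<lambda>\<omega>. S j \<omega> = S (j - 1) \<omega>)" for j
    by (rule measurable_compose_countable[where f="\<lambda>T \<omega>. S j \<omega> = T", OF _ S])
       (auto intro: measurable_compose[OF S])
  then have "(\<lambda>\<omega>. LEAST j. j \<ge> 1 \<and> S j \<omega> = S (j - 1) \<omega>) \<in> measurable N (count_space UNIV)"
    by (intro measurable_Least pred_intros_logic) auto
  then have "(\<lambda>\<omega>. S (LEAST j. j \<ge> 1 \<and> S j \<omega> = S (j - 1) \<omega>) \<omega>) \<in> measurable N (count_space UNIV)"
    by (rule measurable_compose_countable[OF S])
  then have "(\<lambda>\<omega>. UNIV - S (LEAST j. j \<ge> 1 \<and> S j \<omega> = S (j - 1) \<omega>) \<omega>) \<in> measurable N (count_space UNIV)"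
    by (rule measurable_compose) simp
  then have "(\<lambda>\<omega>. if R0 \<omega> = UNIV then UNIV else UNIV - S (LEAST j. j \<ge> 1 \<and> S j \<omega> = S (j - 1) \<omega>) \<omega>)
      \<in> measurable N (count_space UNIV)"
    using measurable_compose[OF R0, of "\<lambda>T. T = UNIV" "count_space UNIV"]
    by (intro measurable_If) (simp_all add: pred_def)
  then show ?thesis
    unfolding rejected_hypotheses_def stopping_index_def Let_def R0_def[symmetric] S_def[symmetric] .
qed

section \<open>Level of resampling quantiles for symmetric data\<close>

lemma (in prob_space) sign_flips_preserve_law:
  fixes V :: "'i \<Rightarrow> 'a \<Rightarrow> 'b::euclidean_space"
  assumes indep: "indep_vars (\<lambda>_. borel) V I"
    and sym: "\<And>i. i \<in> I \<Longrightarrow> distr M borel (\<lambda>\<omega>. - V i \<omega>) = distr M borel (V i)"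
    and s: "\<And>i. i \<in> I \<Longrightarrow> s i \<in> {-1, 1}"
  shows "distr M (PiM I (\<lambda>_. borel)) (\<lambda>\<omega>. \<lambda>i\<in>I. s i *\<^sub>R V i \<omega>) =
         distr M (PiM I (\<lambda>_. borel)) (\<lambda>\<omega>. \<lambda>i\<in>I. V i \<omega>)"
proof (cases "I = {}")
  case True
  then show ?thesis by (simp add: restrict_def)
next
  case False
  have rv: "V i \<in> borel_measurable M" if "i \<in> I" for i
    using indep that by (auto simp: indep_vars_def)
  have indep': "indep_vars (\<lambda>_. borel) (\<lambda>i \<omega>. s i *\<^sub>R V i \<omega>) I"
    by (rule indep_vars_compose2[OF indep]) auto
  have "distr M (PiM I (\<lambda>_. borel)) (\<lambda>\<omega>. \<lambda>i\<in>I. s i *\<^sub>R V i \<omega>)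
      = PiM I (\<lambda>i. distr M borel (\<lambda>\<omega>. s i *\<^sub>R V i \<omega>))"
    by (subst indep_vars_iff_distr_eq_PiM'[symmetric]) (use False rv indep' in auto)
  also have "\<dots> = PiM I (\<lambda>i. distr M borel (V i))"
    by (rule PiM_cong) (use s sym in force)+
  also have "\<dots> = distr M (PiM I (\<lambda>_. borel)) (\<lambda>\<omega>. \<lambda>i\<in>I. V i \<omega>)"
    by (rule indep_vars_iff_distr_eq_PiM'[THEN iffD1, symmetric]) (use False rv indep in auto)
  finally show ?thesis .
qed

text \<open>
  Only the columns with index in \<open>{1..n}\<close> matter, which lets the statistic and its quantile be
  viewed as functions on the product space carrying the joint law of the sample.
\<close>

lemma resampled_sup_cong:
  "(\<And>i. i \<in> {1..n} \<Longrightarrow> X i = X' i) \<Longrightarrow> resampled_sup n C w X = resampled_sup n C w X'"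
  unfolding resampled_sup_def by (intro SUP_cong arg_cong[where f=abs]
      arg_cong2[where f="(*)"] sum.cong) auto

lemma resampling_quantile_cong:
  assumes "\<And>i. i \<in> {1..n} \<Longrightarrow> X i = X' i"
  shows "resampling_quantile n \<eta> X C = resampling_quantile n \<eta> X' C"
proof -
  have "resampled_sup n C w X = resampled_sup n C w X'" for w
    by (rule resampled_sup_cong) (rule assms)
  then show ?thesis unfolding resampling_quantile_def resampled_sup_def[symmetric] by simp
qed

lemma resampled_sup_restrict: "resampled_sup n C w (restrict X {1..n}) = resampled_sup n C w X"
  by (rule resampled_sup_cong) simp

lemma resampling_quantile_restrict: "resampling_quantile n \<eta> (restrict X {1..n}) C
    = resampling_quantile n \<eta> X C"
  by (rule resampling_quantile_cong) simp

text \<open>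
  Replacing \<open>V i\<close> by \<open>w i V i\<close> for fixed signs \<open>w\<close> changes neither the joint law nor the quantile,
  so the event has the same probability for the statistic computed with the weights \<open>w\<close>. Averaging
  over random \<open>w\<close> and exchanging the order of integration yields the conditional exceedance
  probability, which is at most \<open>\<eta>\<close> for each outcome.
\<close>

lemma (in prob_space) symmetric_resampling_level:
  fixes V :: "nat \<Rightarrow> 'a \<Rightarrow> real ^ 'k::finite"
  assumes indep: "indep_vars (\<lambda>_. borel) V {1..n}"
    and sym: "\<And>i. i \<in> {1..n} \<Longrightarrow> distr M borel (\<lambda>\<omega>. - V i \<omega>) = distr M borel (V i)"
    and \<eta>: "0 < \<eta>" "\<eta> < 1"
  shows "prob {\<omega> \<in> space M. resampled_sup n C (\<lambda>_. 1) (\<lambda>i. V i \<omega>)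
      > resampling_quantile n \<eta> (\<lambda>i. V i \<omega>) C} \<le> \<eta>"
proof -
  define E where "E = (\<lambda>w. {\<omega> \<in> space M. resampled_sup n C w (\<lambda>i. V i \<omega>)
      > resampling_quantile n \<eta> (\<lambda>i. V i \<omega>) C})"
  let ?S = "set_pmf (rademacher_signs n)" and ?p = "pmf (rademacher_signs n)"
  let ?L = "PiM {1..n} (\<lambda>_. borel) :: (nat \<Rightarrow> real ^ 'k) measure"
  have rv[measurable]: "V i \<in> borel_measurable M" if "i \<in> {1..n}" for i
    using indep that by (auto simp: indep_vars_def)
  have comp: "(\<lambda>x. x i) \<in> borel_measurable ?L" if "i \<in> {1..n}" for i
    using that by measurable
  define G where "G = {x \<in> space ?L. resampled_sup n C (\<lambda>_. 1) x > resampling_quantile n \<eta> x C}"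
  note [measurable] = resampled_sup_measurable[OF comp] resampling_quantile_measurable[OF comp \<eta>]
    resampled_sup_measurable[OF rv] resampling_quantile_measurable[OF rv \<eta>]
  have G[measurable]: "G \<in> sets ?L" unfolding G_def by measurable
  have E[measurable]: "E w \<in> sets M" for w unfolding E_def by measurable
  have int: "integrable M (\<lambda>\<omega>. ?p w * indicator (E w) \<omega>)" for w
    by (rule integrable_const_bound[where B=1]) (auto simp: indicator_def pmf_le_1)
  have flip: "prob (E (\<lambda>_. 1)) = prob (E w)" if w: "w \<in> ?S" for w
  proof -
    have s: "\<And>i. i \<in> {1..n} \<Longrightarrow> w i \<in> {-1, 1}"
      using w by (auto simp: set_rademacher_signs PiE_dflt_def)
    have q: "resampling_quantile n \<eta> (\<lambda>i. w i *\<^sub>R X i) C = resampling_quantile n \<eta> X C"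
        for X :: "nat \<Rightarrow> real ^ 'k"
      by (rule resampling_quantile_signs) (rule s)
    have "E (\<lambda>_. 1) = (\<lambda>\<omega>. \<lambda>i\<in>{1..n}. V i \<omega>) -` G \<inter> space M"
      unfolding E_def G_def set_eq_iff vimage_def Int_iff mem_Collect_eq resampled_sup_restrict
          resampling_quantile_restrict
      by (auto simp: space_PiM)
    then have "prob (E (\<lambda>_. 1)) = measure (distr M ?L (\<lambda>\<omega>. \<lambda>i\<in>{1..n}. V i \<omega>)) G"
      using measure_distr[OF measurable_restrict[OF rv] G] by simp
    also have "\<dots> = measure (distr M ?L (\<lambda>\<omega>. \<lambda>i\<in>{1..n}. w i *\<^sub>R V i \<omega>)) G"
      using sign_flips_preserve_law[OF indep sym s] by simp
    also have "\<dots> = prob ((\<lambda>\<omega>. \<lambda>i\<in>{1..n}. w i *\<^sub>R V i \<omega>) -` G \<inter> space M)"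
      by (rule measure_distr[OF measurable_restrict G]) measurable
    also have "(\<lambda>\<omega>. \<lambda>i\<in>{1..n}. w i *\<^sub>R V i \<omega>) -` G \<inter> space M = E w"
      unfolding E_def G_def set_eq_iff vimage_def Int_iff mem_Collect_eq resampled_sup_restrict
        resampling_quantile_restrict resampled_sup_signs q
      by (auto simp: space_PiM)
    finally show ?thesis .
  qed
  have "prob (E (\<lambda>_. 1)) = (\<Sum>w\<in>?S. ?p w * prob (E (\<lambda>_. 1)))"
    by (simp add: sum_pmf_eq_1 flip: sum_distrib_right)
  also have "\<dots> = (\<Sum>w\<in>?S. ?p w * prob (E w))"
    by (intro sum.cong) (auto simp: flip)
  also have "\<dots> = (\<Sum>w\<in>?S. (LINT \<omega>|M. ?p w * indicator (E w) \<omega>))"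
    by simp
  also have "\<dots> = (LINT \<omega>|M. (\<Sum>w\<in>?S. ?p w * indicator (E w) \<omega>))"
    by (rule Bochner_Integration.integral_sum[symmetric]) (rule int)
  also have "\<dots> \<le> (LINT \<omega>|M. \<eta>)"
  proof (rule integral_mono)
    fix \<omega> assume "\<omega> \<in> space M"
    then have "(\<Sum>w\<in>?S. ?p w * indicator (E w) \<omega>) = measure_pmf.prob (rademacher_signs n)
        {w. resampled_sup n C w (\<lambda>i. V i \<omega>) > resampling_quantile n \<eta> (\<lambda>i. V i \<omega>) C}"
      by (subst measure_pmf_finite_support) (auto simp: E_def indicator_def)
    also have "\<dots> \<le> \<eta>"
      using resampling_quantile_le_iff[OF \<eta>] by blast
    finally show "(\<Sum>w\<in>?S. ?p w * indicator (E w) \<omega>) \<le> \<eta>" .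
  next
    show "integrable M (\<lambda>\<omega>. \<Sum>w\<in>?S. ?p w * indicator (E w) \<omega>)"
      by (rule Bochner_Integration.integrable_sum) (rule int)
  qed auto
  also have "\<dots> = \<eta>" by (simp add: prob_space)
  finally show ?thesis unfolding E_def .
qed

section \<open>Gaussian vectors and normal tails\<close>

text \<open>
  Integrability gives the assumption on the mean its content, since the Bochner integral of a
  function that is not integrable is 0.
\<close>

lemma (in prob_space) gaussian_vector_integrable:
  fixes Z :: "'a \<Rightarrow> real ^ 'k::finite"
  assumes "gaussian_vector M Z"
  shows "integrable M Z"
proof -
  have comp: "integrable M (\<lambda>\<omega>. b \<bullet> Z \<omega>)" for b
  proof -
    consider (normal) m s where "s > 0" "distributed M lborel (\<lambda>\<omega>. b \<bullet> Z \<omega>) (\<lambda>x. ennreal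
        (normal_density m s x))"
      | (const) m where "AE \<omega> in M. b \<bullet> Z \<omega> = m"
      using assms unfolding gaussian_vector_def by blast
    then show ?thesis
    proof cases
      case normal
      have "integrable lborel (\<lambda>x. normal_density m s x * x)"
        using integrable_normal_moment_nz_1[OF normal(1), of m] by (simp add: mult.commute)
      then show ?thesis
        using distributed_integrable[OF normal(2), of "\<lambda>x. x"] by simp
    next
      case const
      have [measurable]: "Z \<in> borel_measurable M" using assms by (simp add: gaussian_vector_def)
      from const show ?thesis by (subst integrable_cong_AE[where g="\<lambda>_. m"]) auto
    qed
  qed
  have "integrable M (\<lambda>\<omega>. \<Sum>b\<in>Basis. (Z \<omega> \<bullet> b) *\<^sub>R b)"
    by (subst inner_commute) (intro Bochner_Integration.integrable_sum integrable_scaleR_left comp)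
  then show ?thesis by (simp add: euclidean_representation)
qed

lemma (in prob_space) gaussian_vector_centered_form:
  fixes Z :: "'a \<Rightarrow> real ^ 'k::finite"
  assumes Z: "gaussian_vector M Z" and \<mu>: "expectation Z = \<mu>"
  obtains (normal) s where "s > 0" "distributed M lborel (\<lambda>\<omega>. a \<bullet> (Z \<omega> - \<mu>)) (\<lambda>x. ennreal
      (normal_density 0 s x))"
  | (const) "AE \<omega> in M. a \<bullet> (Z \<omega> - \<mu>) = 0"
proof -
  have [measurable]: "Z \<in> borel_measurable M" using Z by (simp add: gaussian_vector_def)
  have int: "integrable M Z" using Z by (rule gaussian_vector_integrable)
  have e: "expectation (\<lambda>\<omega>. a \<bullet> Z \<omega>) = a \<bullet> \<mu>"
    using int \<mu> by simp
  consider (normal') m s where "s > 0" "distributed M lborel (\<lambda>\<omega>. a \<bullet> Z \<omega>) (\<lambda>x. ennreal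
      (normal_density m s x))"
    | (const') m where "AE \<omega> in M. a \<bullet> Z \<omega> = m"
    using Z unfolding gaussian_vector_def by blast
  then show thesis
  proof cases
    case normal'
    have "m = a \<bullet> \<mu>" using normal_distributed_expectation[OF normal'(1,2)] e by simp
    then have "distributed M lborel (\<lambda>\<omega>. - (a \<bullet> \<mu>) + 1 * (a \<bullet> Z \<omega>)) (\<lambda>x. ennreal (normal_density 0 s x))"
      using normal_density_affine[OF normal'(2,1), of 1 "- (a \<bullet> \<mu>)"] by simp
    then show thesis using normal(1)[OF normal'(1)] by (simp add: inner_diff_right)
  next
    case const'
    then have "expectation (\<lambda>\<omega>. a \<bullet> Z \<omega>) = expectation (\<lambda>_. m)" by (intro integral_cong_AE) auto
    then have "m = a \<bullet> \<mu>" using e prob_space by simp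
    then show thesis using const const' by (simp add: inner_diff_right)
  qed
qed

text \<open>
  Every linear form of the centered vector is centered normal or almost surely zero, hence symmetric;
  so the vector and its negative have the same characteristic function.
\<close>

lemma (in prob_space) gaussian_vector_symmetric:
  fixes Z :: "'a \<Rightarrow> real ^ 'k::finite"
  assumes Z: "gaussian_vector M Z" and \<mu>: "expectation Z = \<mu>"
  shows "distr M borel (\<lambda>\<omega>. - (Z \<omega> - \<mu>)) = distr M borel (\<lambda>\<omega>. Z \<omega> - \<mu>)"
proof (rule char_uniqueness_euclidean)
  have [measurable]: "Z \<in> borel_measurable M" using Z by (simp add: gaussian_vector_def)
  show "prob_space (distr M borel (\<lambda>\<omega>. - (Z \<omega> - \<mu>)))" "prob_space (distr M borel (\<lambda>\<omega>. Z \<omega> - \<mu>))"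
    by (auto intro!: prob_space_distr)
  fix a :: "real ^ 'k"
  have "(CLINT \<omega>|M. iexp (- (a \<bullet> (Z \<omega> - \<mu>)))) = (CLINT \<omega>|M. iexp (a \<bullet> (Z \<omega> - \<mu>)))"
  proof (rule gaussian_vector_centered_form[OF Z \<mu>, of a])
    fix s assume s: "s > 0" and D: "distributed M lborel (\<lambda>\<omega>. a \<bullet> (Z \<omega> - \<mu>)) (\<lambda>x. ennreal
        (normal_density 0 s x))"
    have "distributed M lborel (\<lambda>\<omega>. 0 + (-1) * (a \<bullet> (Z \<omega> - \<mu>))) (\<lambda>x. ennreal (normal_density (0
        + (-1) * 0) (\<bar>-1\<bar> * s) x))"
      by (rule normal_density_affine[OF D s]) simp
    then have D': "distributed M lborel (\<lambda>\<omega>. - (a \<bullet> (Z \<omega> - \<mu>))) (\<lambda>x. ennreal (normal_density 0 s x))"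
      by simp
    have "distr M lborel (\<lambda>\<omega>. a \<bullet> (Z \<omega> - \<mu>)) = distr M lborel (\<lambda>\<omega>. - (a \<bullet> (Z \<omega> - \<mu>)))"
      using distributed_distr_eq_density[OF D] distributed_distr_eq_density[OF D'] by simp
    then have "(CLINT x|distr M lborel (\<lambda>\<omega>. - (a \<bullet> (Z \<omega> - \<mu>))). iexp x)
        = (CLINT x|distr M lborel (\<lambda>\<omega>. a \<bullet> (Z \<omega> - \<mu>)). iexp x)"
      by simp
    then show ?thesis by (subst (asm) (1 2) integral_distr) auto
  next
    assume "AE \<omega> in M. a \<bullet> (Z \<omega> - \<mu>) = 0"
    then show ?thesis by (intro integral_cong_AE) auto
  qed
  then show "(CLINT x|distr M borel (\<lambda>\<omega>. - (Z \<omega> - \<mu>)). iexp (a \<bullet> x))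
      = (CLINT x|distr M borel (\<lambda>\<omega>. Z \<omega> - \<mu>). iexp (a \<bullet> x))"
    by (subst (1 2) integral_distr) (auto simp only: inner_minus_right, auto)
qed auto

lemma normal_upper_tail_antimono: "x \<le> y \<Longrightarrow> normal_upper_tail y \<le> normal_upper_tail x"
  unfolding normal_upper_tail_def
  using prob_space_normal_density[of 1 0]
  by (intro finite_measure.finite_measure_mono prob_space.finite_measure) auto

lemma normal_upper_tail_eq_cdf: "normal_upper_tail x = 1 - cdf std_normal_distribution x"
  and isCont_normal_upper_tail: "isCont normal_upper_tail x"
proof -
  interpret real_distribution std_normal_distribution by (rule real_dist_normal_dist)
  \<comment> \<open>The normal law has no atoms, so the closed and the open half-line have the same mass.\<close>
  have zero: "measure std_normal_distribution {x} = 0" for x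
  proof -
    have "emeasure std_normal_distribution {x} = 0"
      by (subst emeasure_density) (auto intro!: nn_integral_0_iff_AE[THEN iffD2]
          AE_I[of _ _ "{x}"] simp: indicator_def)
    then show ?thesis by (simp add: measure_def)
  qed
  show eq: "normal_upper_tail x = 1 - cdf std_normal_distribution x" for x
  proof -
    have "1 - cdf std_normal_distribution x = measure std_normal_distribution {x<..}"
    proof -
      have "UNIV - {..x} = {x<..}" by auto
      then show ?thesis using prob_compl[of "{..x}"] by (simp add: cdf_def)
    qed
    also have "\<dots> = measure std_normal_distribution ({x<..} \<union> {x})"
      using zero[of x] by (subst finite_measure_Union) auto
    also have "{x<..} \<union> {x} = {x..}" by auto
    finally show ?thesis by (simp add: normal_upper_tail_def)
  qed
  have "isCont (cdf std_normal_distribution) x" using zero isCont_cdf by blast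
  then show "isCont normal_upper_tail x" unfolding eq[abs_def] by (intro continuous_intros)
qed

text \<open>
  The intermediate value theorem puts \<open>p\<close> in the range of the tail function, which is what makes the
  inverse in the Bonferroni threshold meaningful.
\<close>

lemma normal_upper_tail_surj:
  assumes "0 < p" "p < 1"
  shows "normal_upper_tail (inv normal_upper_tail p) = p"
proof -
  interpret real_distribution std_normal_distribution by (rule real_dist_normal_dist)
  have "eventually (\<lambda>x. cdf std_normal_distribution x < 1 - p) at_bot"
    using cdf_lim_at_bot assms by (intro order_tendstoD) auto
  then obtain a where a: "cdf std_normal_distribution a < 1 - p" by (auto dest: eventually_happens)
  have "eventually (\<lambda>x. cdf std_normal_distribution x > 1 - p) at_top"
    using cdf_lim_at_top_prob assms by (intro order_tendstoD) auto
  then obtain b where b: "cdf std_normal_distribution b > 1 - p" by (auto dest: eventually_happens)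
  have "a \<le> b" using cdf_nondecreasing[of b a] a b by linarith
  have "\<exists>x. a \<le> x \<and> x \<le> b \<and> normal_upper_tail x = p"
    by (rule IVT2) (use a b \<open>a \<le> b\<close> normal_upper_tail_eq_cdf[of a]
        normal_upper_tail_eq_cdf[of b] isCont_normal_upper_tail in auto)
  then show ?thesis by (metis f_inv_into_f rangeI)
qed

lemma (in prob_space) std_normal_tail:
  assumes U: "distributed M lborel U (\<lambda>x. ennreal (std_normal_density x))"
  shows "prob {\<omega> \<in> space M. \<bar>U \<omega>\<bar> \<ge> z} \<le> 2 * normal_upper_tail z"
proof -
  have one: "prob {\<omega> \<in> space M. X \<omega> \<ge> z} = normal_upper_tail z"
    if D: "distributed M lborel X (\<lambda>x. ennreal (std_normal_density x))" for X
  proof -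
    have X: "X \<in> measurable M lborel" using D by (rule distributed_measurable)
    have "prob {\<omega> \<in> space M. X \<omega> \<ge> z} = measure (distr M lborel X) {z..}"
      by (subst measure_distr[OF X]) (auto intro!: arg_cong[where f=prob])
    then show ?thesis unfolding distributed_distr_eq_density[OF D] normal_upper_tail_def .
  qed
  have "distributed M lborel (\<lambda>x. 0 + (-1) * U x) (\<lambda>x. ennreal (normal_density (0
      + (-1) * 0) (\<bar>-1\<bar> * 1) x))"
    by (rule normal_density_affine[OF U]) simp_all
  then have "distributed M lborel (\<lambda>x. - U x) (\<lambda>x. ennreal (std_normal_density x))" by simp
  note two = one[OF this]
  have [measurable]: "U \<in> borel_measurable M" using distributed_measurable[OF U] by simp
  have "prob {\<omega> \<in> space M. \<bar>U \<omega>\<bar> \<ge> z} \<le> prob ({\<omega> \<in> space M. U \<omega> \<ge> z} \<union> {\<omega> \<in> space M. - U \<omega> \<ge> z})"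
    by (intro finite_measure_mono) auto
  also have "\<dots> \<le> prob {\<omega> \<in> space M. U \<omega> \<ge> z} + prob {\<omega> \<in> space M. - U \<omega> \<ge> z}"
    by (rule measure_Un_le) auto
  finally show "prob {\<omega> \<in> space M. \<bar>U \<omega>\<bar> \<ge> z} \<le> 2 * normal_upper_tail z"
    using one[OF U] two by simp
qed

text \<open>
  At threshold 0 the two-sided bound applies to an event of probability 1.
\<close>

lemma normal_upper_tail_0: "normal_upper_tail 0 \<ge> 1 / 2"
proof -
  interpret N: prob_space std_normal_distribution using prob_space_normal_density[of 1 0] by simp
  have "distributed std_normal_distribution lborel (\<lambda>x. x) (\<lambda>x. ennreal (std_normal_density x))"
    by (auto simp: distributed_def intro!: distr_id2)
  from N.std_normal_tail[OF this, of 0] show ?thesis using N.prob_space by simp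
qed

lemma normal_upper_quantile_nonneg:
  assumes "0 < p" "p < 1 / 2"
  shows "inv normal_upper_tail p \<ge> 0"
  using normal_upper_tail_surj[of p] normal_upper_tail_antimono[of
      "inv normal_upper_tail p" 0] normal_upper_tail_0 assms
  by linarith

section \<open>Family-wise error rate\<close>

lemma sample_mean_deviation:
  fixes X :: "nat \<Rightarrow> real ^ 'k"
  assumes "n \<ge> 1"
  shows "sample_mean n X $ k - \<mu> $ k = 1 / real n * (\<Sum>i=1..n. (X i - \<mu>) $ k)"
  using assms by (simp add: sample_mean_def sum_subtractf field_simps)

text \<open>
  If the coordinate is nondegenerate, its standardised sample mean is standard normal, and replacing
  its standard deviation by the upper bound \<open>s\<close> only raises the threshold, because \<open>z \<ge> 0\<close>.
  Otherwise the deviation vanishes almost surely while the threshold is nonnegative.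
\<close>

lemma (in prob_space) sample_mean_gaussian_tail:
  fixes Y :: "nat \<Rightarrow> 'a \<Rightarrow> real ^ 'k::finite"
  assumes n: "n \<ge> 1"
    and gaussian: "\<And>i. i \<in> {1..n} \<Longrightarrow> gaussian_vector M (Y i)"
    and mean: "\<And>i. i \<in> {1..n} \<Longrightarrow> expectation (Y i) = \<mu>"
    and indep: "indep_vars (\<lambda>_. borel) Y {1..n}"
    and ident: "\<And>i. i \<in> {1..n} \<Longrightarrow> distr M borel (Y i) = distr M borel (Y 1)"
    and s: "coord_sd M (Y 1) k \<le> s" and z: "z \<ge> 0"
  shows "prob {\<omega> \<in> space M. \<bar>sample_mean n (\<lambda>i. Y i \<omega>) $ k - \<mu> $ k\<bar> > 1 / sqrt (real n) * s * z}
    \<le> 2 * normal_upper_tail z"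
proof -
  define V where "V i \<omega> = axis k 1 \<bullet> (Y i \<omega> - \<mu>)" for i \<omega>
  have V: "V i \<omega> = (Y i \<omega> - \<mu>) $ k" for i \<omega> by (simp add: V_def inner_axis' )
  have one: "1 \<in> {1..n}" using n by simp
  have rv[measurable]: "Y i \<in> borel_measurable M" if "i \<in> {1..n}" for i
    using gaussian[OF that] by (simp add: gaussian_vector_def)
  have rvV[measurable]: "V i \<in> borel_measurable M" if "i \<in> {1..n}" for i
    unfolding V_def using rv[OF that] by measurable
  have law: "distr M borel (V i) = distr M borel (V 1)" if i: "i \<in> {1..n}" for i
  proof -
    have "distr M borel (V j) = distr (distr M borel (Y j)) borel (\<lambda>y. axis k 1 \<bullet> (y - \<mu>))" if
        "j \<in> {1..n}" for j
      unfolding V_def by (subst distr_distr) (use rv[OF that] in \<open>auto simp: o_def\<close>)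
    then show ?thesis using i one ident[OF i] by simp
  qed
  have indV: "indep_vars (\<lambda>_. borel) V {1..n}"
    unfolding V_def by (rule indep_vars_compose2[OF indep]) auto
  have dev: "\<bar>sample_mean n (\<lambda>i. Y i \<omega>) $ k - \<mu> $ k\<bar> = \<bar>\<Sum>i=1..n. V i \<omega>\<bar> / real n" for \<omega>
    unfolding sample_mean_deviation[OF n] V by (simp add: abs_mult)
  have tail_nonneg: "normal_upper_tail z \<ge> 0" by (simp add: normal_upper_tail_def)
  have "coord_sd M (Y 1) k \<ge> 0"
    unfolding coord_sd_def by (intro real_sqrt_ge_zero integral_nonneg) auto
  with s have s0: "s \<ge> 0" by linarith
  show ?thesis
  proof (rule gaussian_vector_centered_form[OF gaussian[OF one] mean[OF one], of "axis k 1"])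
    fix \<tau> assume \<tau>: "\<tau> > 0"
      and "distributed M lborel (\<lambda>\<omega>. axis k 1 \<bullet> (Y 1 \<omega> - \<mu>)) (\<lambda>x. ennreal (normal_density 0 \<tau> x))"
    then have D1: "distributed M lborel (V 1) (\<lambda>x. ennreal (normal_density 0 \<tau> x))"
      by (simp add: V_def[abs_def])
    have D: "distributed M lborel (V i) (\<lambda>x. ennreal (normal_density 0 \<tau> x))" if i: "i \<in> {1..n}" for i
    proof -
      have lb: "distr M lborel f = distr M borel f" for f :: "'a \<Rightarrow> real" by (rule distr_cong) auto
      show ?thesis using D1 law[OF i] rvV[OF i] unfolding distributed_def lb by simp
    qed
    have "distributed M lborel (\<lambda>\<omega>. \<mu> $ k + 1 * V 1 \<omega>) (\<lambda>x. ennreal (normal_density (\<mu> $ k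
        + 1 * 0) (\<bar>1\<bar> * \<tau>) x))"
      by (rule normal_density_affine[OF D1 \<tau>]) simp
    then have "distributed M lborel (\<lambda>\<omega>. Y 1 \<omega> $ k) (\<lambda>x. ennreal (normal_density (\<mu> $ k) \<tau> x))"
      by (simp add: V)
    from normal_distributed_variance[OF \<tau> this] have "coord_sd M (Y 1) k = \<tau>"
      using \<tau> by (simp add: coord_sd_def)
    with s have \<tau>s: "\<tau> \<le> s" by simp
    define v where "v = sqrt (real n) * \<tau>"
    have v: "v > 0" using n \<tau> by (simp add: v_def)
    have "distributed M lborel (\<lambda>\<omega>. \<Sum>i=1..n. V i \<omega>) (normal_density (\<Sum>i=1..n. 0) (sqrt (\<Sum>i=1..n. \<tau>\<^sup>2)))"
      by (rule sum_indep_normal) (use n \<tau> D indV in auto)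
    then have "distributed M lborel (\<lambda>\<omega>. \<Sum>i=1..n. V i \<omega>) (normal_density 0 v)"
      using \<tau> by (simp add: v_def real_sqrt_mult)
    then have U: "distributed M lborel (\<lambda>\<omega>. (\<Sum>i=1..n. V i \<omega>) / v) (\<lambda>x. ennreal (std_normal_density x))"
      using normal_standard_normal_convert[OF v, of "\<lambda>\<omega>. \<Sum>i=1..n. V i \<omega>" 0] by simp
    have [measurable]: "(\<lambda>\<omega>. (\<Sum>i=1..n. V i \<omega>) / v) \<in> borel_measurable M"
      using distributed_measurable[OF U] by simp
    have "prob {\<omega> \<in> space M. \<bar>sample_mean n (\<lambda>i. Y i \<omega>) $ k - \<mu> $ k\<bar> > 1 / sqrt (real n) * s * z}
      \<le> prob {\<omega> \<in> space M. \<bar>(\<Sum>i=1..n. V i \<omega>) / v\<bar> \<ge> z}"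
    proof (rule finite_measure_mono)
      show "{\<omega> \<in> space M. \<bar>sample_mean n (\<lambda>i. Y i \<omega>) $ k - \<mu> $ k\<bar> > 1 / sqrt (real n) * s * z}
        \<subseteq> {\<omega> \<in> space M. \<bar>(\<Sum>i=1..n. V i \<omega>) / v\<bar> \<ge> z}"
      proof safe
        fix \<omega> assume "\<bar>sample_mean n (\<lambda>i. Y i \<omega>) $ k - \<mu> $ k\<bar> > 1 / sqrt (real n) * s * z"
        then have *: "\<bar>\<Sum>i=1..n. V i \<omega>\<bar> / real n > s * z / sqrt (real n)" unfolding dev by simp
        have "v * z = sqrt (real n) * (\<tau> * z)" by (simp add: v_def)
        also have "\<dots> \<le> sqrt (real n) * (s * z)" using \<tau>s z by (intro mult_left_mono mult_right_mono) auto
        also have "\<dots> = s * z / sqrt (real n) * real n"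
          using n by (simp add: field_simps)
        also have "\<dots> \<le> \<bar>\<Sum>i=1..n. V i \<omega>\<bar>"
          using * n by (simp add: pos_less_divide_eq less_imp_le)
        finally show "z \<le> \<bar>(\<Sum>i=1..n. V i \<omega>) / v\<bar>" using v by (simp add: field_simps)
      qed
    qed measurable
    also have "\<dots> \<le> 2 * normal_upper_tail z" by (rule std_normal_tail[OF U])
    finally show ?thesis .
  next
    assume "AE \<omega> in M. axis k 1 \<bullet> (Y 1 \<omega> - \<mu>) = 0"
    then have "AE \<omega> in M. V 1 \<omega> = 0" by (simp add: V_def)
    then have "AE x in distr M borel (V 1). x = 0"
      by (subst AE_distr_iff) (use rvV[OF one] in auto)
    then have "AE \<omega> in M. V i \<omega> = 0" if "i \<in> {1..n}" for i
      using rvV[OF that] by (subst (asm) law[OF that, symmetric], subst (asm) AE_distr_iff) auto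
    then have "AE \<omega> in M. \<forall>i\<in>{1..n}. V i \<omega> = 0"
      by (intro AE_finite_allI) auto
    then have "AE \<omega> in M. \<omega> \<notin> {\<omega> \<in> space M. \<bar>sample_mean n (\<lambda>i. Y i \<omega>) $ k - \<mu> $ k\<bar>
        > 1 / sqrt (real n) * s * z}"
    proof eventually_elim
      case (elim \<omega>)
      then have "\<bar>sample_mean n (\<lambda>i. Y i \<omega>) $ k - \<mu> $ k\<bar> = 0" unfolding dev by simp
      then show ?case using s0 z n by (simp add: not_less)
    qed
    then show ?thesis
      using tail_nonneg prob_eq_0_AE[of "\<lambda>\<omega>. \<omega> \<in> {\<omega> \<in> space M. \<bar>sample_mean n (\<lambda>i. Y i \<omega>) $ k - \<mu> $ k\<bar>
          > 1 / sqrt (real n) * s * z}"] by auto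
  qed
qed

text \<open>
  Union bound over the \<open>K\<close> coordinates, each of which contributes two normal tails of mass
  \<open>\<eta> / (2 K)\<close>.
\<close>

lemma (in prob_space) bonf_threshold_coverage:
  fixes Y :: "nat \<Rightarrow> 'a \<Rightarrow> real ^ 'k::finite"
  assumes n: "n \<ge> 1" and \<eta>: "0 < \<eta>" "\<eta> < 1"
    and gaussian: "\<And>i. i \<in> {1..n} \<Longrightarrow> gaussian_vector M (Y i)"
    and mean: "\<And>i. i \<in> {1..n} \<Longrightarrow> expectation (Y i) = \<mu>"
    and indep: "indep_vars (\<lambda>_. borel) Y {1..n}"
    and ident: "\<And>i. i \<in> {1..n} \<Longrightarrow> distr M borel (Y i) = distr M borel (Y 1)"
  shows "prob {\<omega> \<in> space M. \<exists>k. \<bar>sample_mean n (\<lambda>i. Y i \<omega>) $ k - \<mu> $ k\<bar> >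
      bonf_threshold n (coord_sd M (Y 1)) \<eta> UNIV} \<le> \<eta>"
proof -
  define p where "p = \<eta> / (2 * real CARD('k))"
  have K: "real CARD('k) \<ge> 1" using zero_less_card_finite[where 'a='k] by linarith
  have p: "0 < p" "p < 1 / 2" using \<eta> K less_le_trans[OF \<eta>(2) K] by (auto simp: p_def field_simps)
  define z where "z = inv normal_upper_tail p"
  have z: "z \<ge> 0" "normal_upper_tail z = p"
    unfolding z_def using p normal_upper_quantile_nonneg normal_upper_tail_surj by auto
  let ?s = "SUP k. coord_sd M (Y 1) k"
  let ?B = "\<lambda>k. {\<omega> \<in> space M. \<bar>sample_mean n (\<lambda>i. Y i \<omega>) $ k - \<mu> $ k\<bar> > 1 / sqrt (real n) * ?s * z}"
  have rv: "\<And>i. i \<in> {1..n} \<Longrightarrow> Y i \<in> borel_measurable M"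
    using gaussian by (simp add: gaussian_vector_def)
  note borel_measurable_vec_component[OF sample_mean_measurable[OF rv], measurable]
  have "prob (\<Union>k. ?B k) \<le> (\<Sum>k\<in>UNIV. prob (?B k))"
    by (rule finite_measure_subadditive_finite) auto
  also have "\<dots> \<le> (\<Sum>k\<in>(UNIV :: 'k set). 2 * p)"
    unfolding z(2)[symmetric]
    by (intro sum_mono sample_mean_gaussian_tail[OF n gaussian mean indep ident] z cSUP_upper) auto
  also have "\<dots> = \<eta>" using K by (simp add: p_def)
  also have "(\<Union>k. ?B k) = {\<omega> \<in> space M. \<exists>k. \<bar>sample_mean n (\<lambda>i. Y i \<omega>) $ k - \<mu> $ k\<bar> >
      bonf_threshold n (coord_sd M (Y 1)) \<eta> UNIV}"
    by (auto simp: bonf_threshold_def z_def p_def)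
  finally show ?thesis .
qed

text \<open>
  The deterministic core. Write \<open>H\<close> for the set of true hypotheses. Subtracting \<open>\<mu>\<close> changes
  nothing on \<open>H\<close>, so \<open>level\<close> puts the sample means on \<open>H\<close> below the quantile of \<open>H\<close>. By \<open>bonf\<close>
  and \<open>resampling_quantile_le_centered\<close>, with \<open>\<alpha>0\<close> split into \<open>\<alpha>0 (1 - \<delta>)\<close> and \<open>\<alpha>0 \<delta>\<close>, this
  quantile is below the first-step threshold. Hence \<open>H\<close> survives the first step, and then every
  iteration of the second by \<open>step_down_sets_retain\<close>.
\<close>

lemma rejected_hypotheses_avoid:
  fixes X :: "nat \<Rightarrow> real ^ 'k::finite"
  assumes n: "n \<ge> 1" and \<alpha>0: "0 < \<alpha>0" "\<alpha>0 < 1" and \<delta>: "0 < \<delta>" "\<delta> < 1"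
    and level: "resampled_sup n {k. \<mu> $ k = 0} (\<lambda>_. 1) (\<lambda>i. X i - \<mu>)
        \<le> resampling_quantile n \<alpha>0 (\<lambda>i. X i - \<mu>) {k. \<mu> $ k = 0}"
    and bonf: "\<And>k. \<bar>sample_mean n X $ k - \<mu> $ k\<bar> \<le> bonf_threshold n \<sigma> (\<alpha> - \<alpha>0) UNIV"
  shows "rejected_hypotheses n \<sigma> \<alpha> \<alpha>0 \<delta> X \<inter> {k. \<mu> $ k = 0} = {}"
proof (cases "{k. \<mu> $ k = 0} = {}")
  case False
  let ?H = "{k. \<mu> $ k = 0}"
  have eq: "resampled_sup n ?H w (\<lambda>i. X i - \<mu>) = resampled_sup n ?H w X" for w
    unfolding resampled_sup_def by (intro SUP_cong) auto
  have q: "resampling_quantile n \<alpha>0 (\<lambda>i. X i - \<mu>) ?H = resampling_quantile n \<alpha>0 X ?H"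
    unfolding resampling_quantile_def resampled_sup_def[symmetric] eq ..
  have mean: "\<bar>sample_mean n X $ k\<bar> \<le> resampling_quantile n \<alpha>0 X ?H" if "k \<in> ?H" for k
    using level that unfolding resampled_sup_le_iff[OF False] q
    by (auto simp: sample_mean_def)
  have "\<alpha>0 * (1 - \<delta>) < 1"
    using \<alpha>0 \<delta> mult_strict_mono[of \<alpha>0 1 "1 - \<delta>" 1] by auto
  moreover have "\<alpha>0 * (1 - \<delta>) + \<alpha>0 * \<delta> = \<alpha>0" by (simp add: algebra_simps)
  ultimately have "resampling_quantile n \<alpha>0 X ?H \<le> quant_bonf_threshold n \<sigma> \<alpha> \<alpha>0 \<delta> X UNIV"
    using resampling_quantile_le_centered[OF n, of "\<alpha>0 * (1 - \<delta>)"
        "\<alpha>0 * \<delta>" X \<mu>, OF _ _ _ _ bonf False] \<alpha>0 \<delta>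
    by (simp add: quant_bonf_threshold_def q)
  with mean have R0: "?H \<subseteq> UNIV - initial_rejections n \<sigma> \<alpha> \<alpha>0 \<delta> X"
    unfolding initial_rejections_def by fastforce
  then have "?H \<subseteq> step_down_sets n \<alpha>0 X (UNIV - initial_rejections n \<sigma> \<alpha> \<alpha>0 \<delta> X) j" for j
    using step_down_sets_retain[OF \<alpha>0 False _ mean] by blast
  then show ?thesis using R0 False unfolding rejected_hypotheses_def Let_def by auto
qed simp

theorem proposition3p4:
  fixes M :: "'a measure"
    and Y :: "nat \<Rightarrow> 'a \<Rightarrow> real ^ 'k"
    and \<mu> :: "real ^ 'k"
    and n :: nat
    and \<alpha> \<delta> \<alpha>0 :: real
  assumes "prob_space M"
    and "n \<ge> 2"
    and "0 < \<alpha>" "\<alpha> < 1"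
    and "0 < \<delta>" "\<delta> < 1"
    and "0 < \<alpha>0" "\<alpha>0 < \<alpha>"
    and gaussian: "\<And>i. i \<in> {1..n} \<Longrightarrow> gaussian_vector M (Y i)"
    and mean: "\<And>i. i \<in> {1..n} \<Longrightarrow> prob_space.expectation M (Y i) = \<mu>"
    and indep: "prob_space.indep_vars M (\<lambda>_. borel) Y {1..n}"
    and ident: "\<And>i. i \<in> {1..n} \<Longrightarrow> distr M borel (Y i) = distr M borel (Y 1)"
  shows "let R = (\<lambda>\<omega>. rejected_hypotheses n (coord_sd M (Y 1)) \<alpha> \<alpha>0 \<delta> (\<lambda>i. Y i \<omega>));
             F = {\<omega> \<in> space M. \<exists>k. \<mu> $ k = 0 \<and> k \<in> R \<omega>}
         in F \<in> sets M \<and> measure M F \<le> \<alpha>"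
proof -
  interpret prob_space M by fact
  have n: "n \<ge> 1" and \<alpha>0: "0 < \<alpha>0" "\<alpha>0 < 1" using assms by auto
  define R where "R \<omega> = rejected_hypotheses n (coord_sd M (Y 1)) \<alpha> \<alpha>0 \<delta> (\<lambda>i. Y i \<omega>)" for \<omega>
  define F where "F = {\<omega> \<in> space M. \<exists>k. \<mu> $ k = 0 \<and> k \<in> R \<omega>}"
  define V where "V i \<omega> = Y i \<omega> - \<mu>" for i \<omega>
  let ?H = "{k. \<mu> $ k = 0}"
  \<comment> \<open>The two exceptional events: some true hypothesis exceeds the resampling quantile of the true
    hypotheses, or some sample mean leaves the Bonferroni band around \<open>\<mu>\<close>.\<close>
  define A where "A = {\<omega> \<in> space M. resampled_sup n ?H (\<lambda>_. 1) (\<lambda>i. V i \<omega>)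
      > resampling_quantile n \<alpha>0 (\<lambda>i. V i \<omega>) ?H}"
  define B where "B = {\<omega> \<in> space M. \<exists>k. \<bar>sample_mean n (\<lambda>i. Y i \<omega>) $ k - \<mu> $ k\<bar> >
      bonf_threshold n (coord_sd M (Y 1)) (\<alpha> - \<alpha>0) UNIV}"
  have rv: "\<And>i. i \<in> {1..n} \<Longrightarrow> Y i \<in> borel_measurable M"
    using gaussian by (simp add: gaussian_vector_def)
  then have rvV: "\<And>i. i \<in> {1..n} \<Longrightarrow> V i \<in> borel_measurable M"
    unfolding V_def by measurable
  have "R \<in> measurable M (count_space UNIV)"
    unfolding R_def[abs_def] by (rule rejected_hypotheses_measurable[OF rv \<alpha>0 \<open>0 < \<delta>\<close> \<open>\<delta> < 1\<close>])
  then have "R -` {S. \<exists>k. \<mu> $ k = 0 \<and> k \<in> S} \<inter> space M \<in> sets M"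
    by (rule measurable_sets) (simp only: sets_count_space Pow_UNIV UNIV_I)
  also have "R -` {S. \<exists>k. \<mu> $ k = 0 \<and> k \<in> S} \<inter> space M = F"
    unfolding F_def by blast
  finally have F: "F \<in> sets M" .
  note [measurable] = resampled_sup_measurable[OF rvV] resampling_quantile_measurable[OF rvV \<alpha>0]
    borel_measurable_vec_component[OF sample_mean_measurable[OF rv]]
  have meas: "A \<in> sets M" "B \<in> sets M" unfolding A_def B_def by measurable
  have A: "prob A \<le> \<alpha>0"
    unfolding A_def
  proof (rule symmetric_resampling_level[OF _ _ \<alpha>0])
    show "indep_vars (\<lambda>_. borel) V {1..n}"
      unfolding V_def by (rule indep_vars_compose2[OF indep]) auto
    show "distr M borel (\<lambda>\<omega>. - V i \<omega>) = distr M borel (V i)" if "i \<in> {1..n}" for i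
      unfolding V_def using gaussian_vector_symmetric[OF gaussian[OF that] mean[OF that]] .
  qed
  have B: "prob B \<le> \<alpha> - \<alpha>0"
    unfolding B_def using assms by (intro bonf_threshold_coverage[OF n _ _ gaussian mean indep ident]) auto
  have "F \<subseteq> A \<union> B"
  proof (rule subsetI, rule ccontr)
    fix \<omega> assume \<omega>: "\<omega> \<in> F" "\<omega> \<notin> A \<union> B"
    then have "R \<omega> \<inter> ?H = {}"
      unfolding R_def
      by (intro rejected_hypotheses_avoid[OF n \<alpha>0 \<open>0 < \<delta>\<close> \<open>\<delta> < 1\<close>])
         (auto simp: F_def A_def B_def V_def not_less)
    with \<omega> show False by (auto simp: F_def)
  qed
  then have "prob F \<le> prob (A \<union> B)" using meas by (intro finite_measure_mono) auto
  also have "\<dots> \<le> prob A + prob B" using meas by (rule measure_Un_le)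
  finally have "prob F \<le> \<alpha>" using A B by linarith
  with F show ?thesis unfolding F_def R_def Let_def by blast
qed

end
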